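(* Let $\mathbb{F}_q$ be a finite field of order $q$ ($q$ a prime power), let $G=(V,E)$ be a network as in the context with set of sink nodes $T$, and let $\omega\ge1$ be an integer with $C_t\ge\omega$ for all $t\in T$. For $t\in T$ let $\delta_t=C_t-\omega$. If $$q>\sum_{t\in T}\big|\mathcal{A}_t(\delta_t)\big|,$$ then there exists an $\mathbb{F}_q$-valued rate-$\omega$ LNEC MDS code on $G$, i.e., an $\mathbb{F}_q$-valued rate-$\omega$ LNEC code with $\dim\Phi(t)=\omega$ and $d_{\min}^{(t)}=C_t-\omega+1$ for every $t\in T$.
   Context: Network: $G=(V,E)$ is a finite directed acyclic graph (parallel edges allowed) with a single source node $s$ and a set of sink nodes $T\subseteq V\setminus\{s\}$; $s$ has no incoming edges and sink nodes have no outgoing edges. For an edge $e$, $\mathrm{tail}(e)$, $\mathrm{head}(e)$ are its tail and head; $\mathrm{In}(v)$, $\mathrm{Out}(v)$ are the incoming/outgoing edge sets of node $v$. A directed path is a sequence of edges $(e_1,\dots,e_m)$, $m\ge1$, with $\mathrm{tail}(e_{k+1})=\mathrm{head}(e_k)$. A cut separating node $v$ from node $u$ is a set of edges whose removal leaves no directed path from $u$ to $v$; $C_t$ is the minimum size of a cut separating sink $t$ from $s$. LNEC code: with rate $\omega$ and finite field $\mathbb{F}_q$, introduce imaginary source edges $d_1',\dots,d_\omega'$ ending at $s$ with $\mathrm{In}(s)=\{d_1',\dots,d_\omega'\}$, and for each $e\in E$ an imaginary error edge $e'$ with head $\mathrm{tail}(e)$; $E'=\{e':e\in E\}$ (for non-source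 nodes, $\mathrm{In}(v)$ contains only edges of $E$). An $\mathbb{F}_q$-valued rate-$\omega$ LNEC code is given by local encoding coefficients $k_{d,e}\in\mathbb{F}_q$ for $e\in E$, $d\in\mathrm{In}(\mathrm{tail}(e))$. Extended global encoding kernels are vectors in $\mathbb{F}_q^{\omega+|E|}$ indexed by $\{d_i'\}\cup E'$: $\tilde f_{d_i'}=1_{d_i'}$, $\tilde f_{e'}=1_{e'}$ (standard basis vectors), and recursively in topological order $\tilde f_e=\sum_{d\in\mathrm{In}(\mathrm{tail}(e))}k_{d,e}\tilde f_d+1_{e'}$. For sink $t$, $\mathrm{row}_t(d')=(\tilde f_{\hat e}(d'):\hat e\in\mathrm{In}(t))$. Message space $\Phi(t)=\langle\mathrm{row}_t(d_i'):1\le i\le\omega\rangle$; error space $\Delta(t,\xi)=\langle\mathrm{row}_t(e'):e\in\xi\rangle$ for $\xi\subseteq E$. Minimum distance at $t$: $d_{\min}^{(t)}=\min\{|\xi|:\xi\subseteq E,\ \Phi(t)\cap\Delta(t,\xi)\neq\{0\}\}$. Graph notions: for $\xi\subseteq E$ and a node $u$, $A\subseteq E$ is a cut separating $u$ from $\xi$ if every directed path in $G$ whose first edge lies in $\xi$ and whose last edge has head $u$ contains an edge of $A$; $\mathrm{mincut}(\xi,u)$ is the minimum size of such a cut. A minimum cut separating $u$ from $\xi$ is primary if it separates $u$ from every minimum cut separating $u$ from $\xi$; it exists and is unique. $\xi$ is primary for $u$ if $\xi$ is the primary minimum cut separating $u$ from $\xi$. $\mathcal{A}_t(r)=\{\xi\subseteq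 E:|\xi|=r,\ \xi\text{ primary for }t\}$. *)

theory Defs
  imports Complex_Main "HOL-Library.Function_Algebras"
begin

text \<open>A network is given by a node set V, an edge set E (edges are elements of a type 'e,
 so parallel edges are allowed), tail/head maps, a source s and a set of sinks T.\<close>

definition is_path :: "'e set \<Rightarrow> ('e \<Rightarrow> 'v) \<Rightarrow> ('e \<Rightarrow> 'v) \<Rightarrow> 'e list \<Rightarrow> bool" where
  "is_path E tail head p \<longleftrightarrow> p \<noteq> [] \<and> set p \<subseteq> E \<and>
     (\<forall>k. Suc k < length p \<longrightarrow> tail (p ! Suc k) = head (p ! k))"

definition network :: "'v set \<Rightarrow> 'e set \<Rightarrow> ('e \<Rightarrow> 'v) \<Rightarrow> ('e \<Rightarrow> 'v) \<Rightarrow> 'v \<Rightarrow> 'v set \<Rightarrow> bool" where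
  "network V E tail head s T \<longleftrightarrow>
     finite V \<and> finite E \<and> (\<forall>e\<in>E. tail e \<in> V \<and> head e \<in> V) \<and>
     (\<forall>p. is_path E tail head p \<longrightarrow> tail (hd p) \<noteq> head (last p)) \<and>
     s \<in> V \<and> T \<subseteq> V - {s} \<and>
     (\<forall>e\<in>E. head e \<noteq> s) \<and> (\<forall>e\<in>E. tail e \<notin> T)"

definition node_cut :: "'e set \<Rightarrow> ('e \<Rightarrow> 'v) \<Rightarrow> ('e \<Rightarrow> 'v) \<Rightarrow> 'v \<Rightarrow> 'v \<Rightarrow> 'e set \<Rightarrow> bool" where
  "node_cut E tail head u v A \<longleftrightarrow> A \<subseteq> E \<and>
     (\<forall>p. is_path E tail head p \<and> tail (hd p) = u \<and> head (last p) = v \<longrightarrow> set p \<inter> A \<noteq> {})"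

definition node_mincut :: "'e set \<Rightarrow> ('e \<Rightarrow> 'v) \<Rightarrow> ('e \<Rightarrow> 'v) \<Rightarrow> 'v \<Rightarrow> 'v \<Rightarrow> nat" where
  "node_mincut E tail head u v = Min {card A | A. node_cut E tail head u v A}"

definition edge_cut :: "'e set \<Rightarrow> ('e \<Rightarrow> 'v) \<Rightarrow> ('e \<Rightarrow> 'v) \<Rightarrow> 'e set \<Rightarrow> 'v \<Rightarrow> 'e set \<Rightarrow> bool" where
  "edge_cut E tail head \<xi> u A \<longleftrightarrow> A \<subseteq> E \<and>
     (\<forall>p. is_path E tail head p \<and> hd p \<in> \<xi> \<and> head (last p) = u \<longrightarrow> set p \<inter> A \<noteq> {})"

definition edge_mincut :: "'e set \<Rightarrow> ('e \<Rightarrow> 'v) \<Rightarrow> ('e \<Rightarrow> 'v) \<Rightarrow> 'e set \<Rightarrow> 'v \<Rightarrow> nat" where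
  "edge_mincut E tail head \<xi> u = Min {card A | A. edge_cut E tail head \<xi> u A}"

definition primary_mincut :: "'e set \<Rightarrow> ('e \<Rightarrow> 'v) \<Rightarrow> ('e \<Rightarrow> 'v) \<Rightarrow> 'e set \<Rightarrow> 'v \<Rightarrow> 'e set \<Rightarrow> bool" where
  "primary_mincut E tail head \<xi> u A \<longleftrightarrow>
     edge_cut E tail head \<xi> u A \<and> card A = edge_mincut E tail head \<xi> u \<and>
     (\<forall>B. edge_cut E tail head \<xi> u B \<and> card B = edge_mincut E tail head \<xi> u
          \<longrightarrow> edge_cut E tail head B u A)"

definition primary_for :: "'e set \<Rightarrow> ('e \<Rightarrow> 'v) \<Rightarrow> ('e \<Rightarrow> 'v) \<Rightarrow> 'e set \<Rightarrow> 'v \<Rightarrow> bool" where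
  "primary_for E tail head \<xi> u \<longleftrightarrow> primary_mincut E tail head \<xi> u \<xi>"

definition A_set :: "'e set \<Rightarrow> ('e \<Rightarrow> 'v) \<Rightarrow> ('e \<Rightarrow> 'v) \<Rightarrow> 'v \<Rightarrow> nat \<Rightarrow> 'e set set" where
  "A_set E tail head t r = {\<xi>. \<xi> \<subseteq> E \<and> card \<xi> = r \<and> primary_for E tail head \<xi> t}"

text \<open>Extended global encoding kernels are vectors indexed by nat + 'e:
  Inl i (1 \<le> i \<le> \<omega>) stands for the imaginary source edge d_i', Inr e for the imaginary
  error edge e'. A code is given by local coefficients kS i e = k_{d_i',e} (for tail e = s)
  and kE d e = k_{d,e} (for d \<in> E with head d = tail e).\<close>

definition unitv :: "'i \<Rightarrow> 'i \<Rightarrow> 'a::zero_neq_one" where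
  "unitv x = (\<lambda>y. if y = x then 1 else 0)"

definition vscale :: "'a::times \<Rightarrow> ('i \<Rightarrow> 'a) \<Rightarrow> ('i \<Rightarrow> 'a)" where
  "vscale c v = (\<lambda>y. c * v y)"

definition kernel_eqs :: "'e set \<Rightarrow> ('e \<Rightarrow> 'v) \<Rightarrow> ('e \<Rightarrow> 'v) \<Rightarrow> 'v \<Rightarrow> nat \<Rightarrow>
    (nat \<Rightarrow> 'e \<Rightarrow> 'a::field) \<Rightarrow> ('e \<Rightarrow> 'e \<Rightarrow> 'a) \<Rightarrow> ('e \<Rightarrow> (nat + 'e) \<Rightarrow> 'a) \<Rightarrow> bool" where
  "kernel_eqs E tail head s \<omega> kS kE F \<longleftrightarrow>
     (\<forall>e. e \<notin> E \<longrightarrow> F e = (\<lambda>_. 0)) \<and>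
     (\<forall>e\<in>E. F e =
        (if tail e = s then (\<Sum>i\<in>{1..\<omega>}. vscale (kS i e) (unitv (Inl i)))
         else (\<Sum>d\<in>{d\<in>E. head d = tail e}. vscale (kE d e) (F d)))
        + unitv (Inr e))"

text \<open>On an acyclic network the recursion has a unique solution.\<close>
definition ext_kernel :: "'e set \<Rightarrow> ('e \<Rightarrow> 'v) \<Rightarrow> ('e \<Rightarrow> 'v) \<Rightarrow> 'v \<Rightarrow> nat \<Rightarrow>
    (nat \<Rightarrow> 'e \<Rightarrow> 'a::field) \<Rightarrow> ('e \<Rightarrow> 'e \<Rightarrow> 'a) \<Rightarrow> 'e \<Rightarrow> (nat + 'e) \<Rightarrow> 'a" where
  "ext_kernel E tail head s \<omega> kS kE = (THE F. kernel_eqs E tail head s \<omega> kS kE F)"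

definition row :: "'e set \<Rightarrow> ('e \<Rightarrow> 'v) \<Rightarrow> ('e \<Rightarrow> 'v) \<Rightarrow> 'v \<Rightarrow> nat \<Rightarrow>
    (nat \<Rightarrow> 'e \<Rightarrow> 'a::field) \<Rightarrow> ('e \<Rightarrow> 'e \<Rightarrow> 'a) \<Rightarrow> 'v \<Rightarrow> (nat + 'e) \<Rightarrow> 'e \<Rightarrow> 'a" where
  "row E tail head s \<omega> kS kE t x =
     (\<lambda>e'. if e' \<in> E \<and> head e' = t then ext_kernel E tail head s \<omega> kS kE e' x else 0)"

definition msg_space :: "'e set \<Rightarrow> ('e \<Rightarrow> 'v) \<Rightarrow> ('e \<Rightarrow> 'v) \<Rightarrow> 'v \<Rightarrow> nat \<Rightarrow>
    (nat \<Rightarrow> 'e \<Rightarrow> 'a::field) \<Rightarrow> ('e \<Rightarrow> 'e \<Rightarrow> 'a) \<Rightarrow> 'v \<Rightarrow> ('e \<Rightarrow> 'a) set" where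
  "msg_space E tail head s \<omega> kS kE t =
     Modules.module.span vscale ((\<lambda>i. row E tail head s \<omega> kS kE t (Inl i)) ` {1..\<omega>})"

definition err_space :: "'e set \<Rightarrow> ('e \<Rightarrow> 'v) \<Rightarrow> ('e \<Rightarrow> 'v) \<Rightarrow> 'v \<Rightarrow> nat \<Rightarrow>
    (nat \<Rightarrow> 'e \<Rightarrow> 'a::field) \<Rightarrow> ('e \<Rightarrow> 'e \<Rightarrow> 'a) \<Rightarrow> 'v \<Rightarrow> 'e set \<Rightarrow> ('e \<Rightarrow> 'a) set" where
  "err_space E tail head s \<omega> kS kE t \<xi> =
     Modules.module.span vscale ((\<lambda>e. row E tail head s \<omega> kS kE t (Inr e)) ` \<xi>)"

definition dmin :: "'e set \<Rightarrow> ('e \<Rightarrow> 'v) \<Rightarrow> ('e \<Rightarrow> 'v) \<Rightarrow> 'v \<Rightarrow> nat \<Rightarrow>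
    (nat \<Rightarrow> 'e \<Rightarrow> 'a::field) \<Rightarrow> ('e \<Rightarrow> 'e \<Rightarrow> 'a) \<Rightarrow> 'v \<Rightarrow> nat" where
  "dmin E tail head s \<omega> kS kE t =
     Min {card \<xi> | \<xi>. \<xi> \<subseteq> E \<and>
        msg_space E tail head s \<omega> kS kE t \<inter> err_space E tail head s \<omega> kS kE t \<xi> \<noteq> {0}}"

definition LNEC_MDS :: "'e set \<Rightarrow> ('e \<Rightarrow> 'v) \<Rightarrow> ('e \<Rightarrow> 'v) \<Rightarrow> 'v \<Rightarrow> 'v set \<Rightarrow> nat \<Rightarrow>
    (nat \<Rightarrow> 'e \<Rightarrow> 'a::field) \<Rightarrow> ('e \<Rightarrow> 'e \<Rightarrow> 'a) \<Rightarrow> bool" where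
  "LNEC_MDS E tail head s T \<omega> kS kE \<longleftrightarrow>
     (\<forall>t\<in>T. Vector_Spaces.vector_space.dim vscale (msg_space E tail head s \<omega> kS kE t) = \<omega> \<and>
        dmin E tail head s \<omega> kS kE t = node_mincut E tail head s t - \<omega> + 1)"

end

theory Submission
  imports Defs
begin

text \<open>
  The row of the transfer matrix at \<open>t\<close> belonging to an error on \<open>e\<close> is the sum of the rows of
  the successors of \<open>e\<close>, weighted by the local coefficients (plus a unit vector if \<open>e\<close> enters \<open>t\<close>).
  Hence the rows of \<open>\<xi>\<close> lie in the span of the rows of any cut between \<open>\<xi>\<close> and \<open>t\<close>. As every edge
  set of size at most \<open>\<delta>\<^sub>t\<close> is cut off from \<open>t\<close> by a primary set of size exactly \<open>\<delta>\<^sub>t\<close>, it suffices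
  that for every \<open>t\<close> and every \<open>\<xi> \<in> A\<^sub>t(\<delta>\<^sub>t)\<close> the \<open>\<omega>\<close> message rows and the rows of \<open>\<xi>\<close> are
  linearly independent. For a single pair \<open>(t, \<xi>)\<close> suitable coefficients exist by a Menger-type
  argument. Changing one coefficient perturbs the transfer matrix by a matrix of rank one, so each
  pair excludes at most one value for it, and the coefficients can be fixed one at a time as soon as
  the field has more elements than there are pairs.
\<close>

subsection \<open>Cuts and primary minimum cuts\<close>

lemma is_path_Cons:
  "is_path E tail head (f # p) \<longleftrightarrow>
     f \<in> E \<and> (p = [] \<or> is_path E tail head p \<and> tail (hd p) = head f)"
proof (cases p)
  case Nil
  then show ?thesis by (auto simp: is_path_def)
next
  case (Cons g q)
  then show ?thesis
    by (auto simp: is_path_def nth_Cons hd_conv_nth split: nat.splits)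
qed

lemma is_path_appendD:
  "is_path E tail head (p @ q) \<Longrightarrow> q \<noteq> [] \<Longrightarrow> is_path E tail head q"
  by (induction p) (auto simp: is_path_Cons)

lemma is_path_hd_in: "is_path E tail head p \<Longrightarrow> hd p \<in> E"
  by (auto simp: is_path_def)

lemma edge_cutD:
  "edge_cut E tail head \<xi> u A \<Longrightarrow> is_path E tail head p \<Longrightarrow> hd p \<in> \<xi> \<Longrightarrow> head (last p) = u \<Longrightarrow>
     set p \<inter> A \<noteq> {}"
  by (simp add: edge_cut_def)

lemma edge_cutI:
  assumes "A \<subseteq> E"
    and "\<And>p. is_path E tail head p \<Longrightarrow> hd p \<in> \<xi> \<Longrightarrow> hd p \<in> E \<Longrightarrow> head (last p) = u \<Longrightarrow> set p \<inter> A \<noteq> {}"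
  shows "edge_cut E tail head \<xi> u A"
  using assms is_path_hd_in[of E tail head] unfolding edge_cut_def by blast

text \<open>A path that meets \<open>B\<close> in an edge \<open>b\<close> has a suffix starting at
  \<open>b\<close>, and \<open>A\<close> meets this suffix.\<close>

lemma edge_cut_trans:
  assumes "edge_cut E tail head \<xi> u B" and "edge_cut E tail head B u A"
  shows "edge_cut E tail head \<xi> u A"
  unfolding edge_cut_def
proof (intro conjI allI impI)
  show "A \<subseteq> E" using assms(2) by (simp add: edge_cut_def)
  fix p assume p: "is_path E tail head p \<and> hd p \<in> \<xi> \<and> head (last p) = u"
  then obtain b where "b \<in> set p" "b \<in> B" using assms(1) by (auto simp: edge_cut_def)
  then obtain xs ys where ys: "p = xs @ b # ys" by (meson split_list)
  then have "is_path E tail head (b # ys)" "head (last (b # ys)) = u"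
    using p by (auto intro: is_path_appendD)
  then have "set (b # ys) \<inter> A \<noteq> {}" using edge_cutD[OF assms(2), of "b # ys"] \<open>b \<in> B\<close> by simp
  then show "set p \<inter> A \<noteq> {}" using ys by auto
qed

lemma edge_cut_mono:
  "edge_cut E tail head \<xi> u A \<Longrightarrow> \<eta> \<subseteq> \<xi> \<Longrightarrow> edge_cut E tail head \<eta> u A"
  unfolding edge_cut_def by blast

lemma edge_cut_self: "\<xi> \<subseteq> E \<Longrightarrow> edge_cut E tail head \<xi> u \<xi>"
  by (auto simp: edge_cut_def is_path_def intro: hd_in_set)

lemma edge_cut_Un:
  "edge_cut E tail head \<xi> u A \<Longrightarrow> edge_cut E tail head \<eta> u A \<Longrightarrow> edge_cut E tail head (\<xi> \<union> \<eta>) u A"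
  unfolding edge_cut_def by blast

lemma edge_cut_singletonI:
  assumes "A \<subseteq> E" and "\<And>f. f \<in> \<xi> \<inter> E \<Longrightarrow> edge_cut E tail head {f} u A"
  shows "edge_cut E tail head \<xi> u A"
  using assms(1)
proof (rule edge_cutI)
  fix p assume "is_path E tail head p" "hd p \<in> \<xi>" "hd p \<in> E" "head (last p) = u"
  then show "set p \<inter> A \<noteq> {}" by (intro edge_cutD[OF assms(2)[of "hd p"]]) auto
qed

lemma node_cut_iff_edge_cut:
  "node_cut E tail head u v A \<longleftrightarrow> edge_cut E tail head {e \<in> E. tail e = u} v A"
  using is_path_hd_in[of E tail head] unfolding node_cut_def edge_cut_def by blast

lemma node_mincut_eq_edge_mincut:
  "node_mincut E tail head u v = edge_mincut E tail head {e \<in> E. tail e = u} v"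
  by (simp add: node_mincut_def edge_mincut_def node_cut_iff_edge_cut)

locale finite_graph =
  fixes E :: "'e set" and tail head :: "'e \<Rightarrow> 'v"
  assumes finite_E: "finite E"
begin

abbreviation cut :: "'e set \<Rightarrow> 'v \<Rightarrow> 'e set \<Rightarrow> bool" where
  "cut \<equiv> edge_cut E tail head"

abbreviation mincut :: "'e set \<Rightarrow> 'v \<Rightarrow> nat" where
  "mincut \<equiv> edge_mincut E tail head"

section \<open>Cuts as boundaries of edge sets\<close>

definition succs :: "'e \<Rightarrow> 'e set" where
  "succs e = {g \<in> E. tail g = head e}"

lemma finite_succs: "finite (succs e)"
  by (simp add: succs_def finite_E)

text \<open>For \<open>A \<subseteq> E\<close> this is the largest subset of \<open>E\<close> that
  \<open>A\<close> cuts off from \<open>u\<close>. It turns questions about cuts into questions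
  about sets ordered by inclusion.\<close>

definition separated :: "'v \<Rightarrow> 'e set \<Rightarrow> 'e set" where
  "separated u A = {f \<in> E. cut {f} u A}"

text \<open>In the line digraph this is the inner vertex boundary of \<open>X\<close>, with the node
  \<open>u\<close> treated as a vertex outside \<open>X\<close>.\<close>

definition boundary :: "'v \<Rightarrow> 'e set \<Rightarrow> 'e set" where
  "boundary u X = {f \<in> X. head f = u \<or> \<not> succs f \<subseteq> X}"

lemma cut_iff_separated:
  assumes "A \<subseteq> E" "\<xi> \<subseteq> E"
  shows "cut \<xi> u A \<longleftrightarrow> \<xi> \<subseteq> separated u A"
proof
  show "\<xi> \<subseteq> separated u A" if "cut \<xi> u A"
    using assms(2) edge_cut_mono[OF that] by (auto simp: separated_def)
  show "cut \<xi> u A" if "\<xi> \<subseteq> separated u A"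
    using assms(1) by (rule edge_cut_singletonI) (use that in \<open>auto simp: separated_def\<close>)
qed

text \<open>Following a path from its first edge in \<open>X\<close>, consider the last edge before
  it first leaves \<open>X\<close>, or its final edge if it never does: there the path either steps
  outside \<open>X\<close> or enters \<open>u\<close>.\<close>

lemma cut_boundary:
  assumes "X \<subseteq> E"
  shows "cut X u (boundary u X)"
proof -
  have "set p \<inter> boundary u X \<noteq> {}"
    if "is_path E tail head p" "hd p \<in> X" "head (last p) = u" for p
    using that
  proof (induction p)
    case Nil
    then show ?case by (simp add: is_path_def)
  next
    case (Cons f p)
    show ?case
    proof (cases "p = []")
      case True
      then show ?thesis using Cons by (auto simp: boundary_def)
    next
      case False
      then have p: "is_path E tail head p" "tail (hd p) = head f" "head (last p) = u"
        using Cons by (auto simp: is_path_Cons)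
      show ?thesis
      proof (cases "hd p \<in> X")
        case True
        then show ?thesis using Cons.IH p by auto
      next
        case False
        then have "f \<in> boundary u X"
          using p Cons.prems is_path_hd_in[OF p(1)] by (auto simp: boundary_def succs_def)
        then show ?thesis by auto
      qed
    qed
  qed
  then show ?thesis using assms by (auto simp: edge_cut_def boundary_def)
qed

text \<open>Outside \<open>A\<close>, an edge that enters \<open>u\<close> or has a successor with
  an \<open>A\<close>-avoiding path to \<open>u\<close> would itself start an
  \<open>A\<close>-avoiding path to \<open>u\<close>. With \<open>cut_boundary\<close>, minimum cuts
  become boundaries of minimum size.\<close>

lemma boundary_separated_subset:
  assumes "A \<subseteq> E"
  shows "boundary u (separated u A) \<subseteq> A"
proof
  fix f assume f: "f \<in> boundary u (separated u A)"
  show "f \<in> A"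
  proof (rule ccontr)
    assume "f \<notin> A"
    have fE: "f \<in> E" and fcut: "cut {f} u A"
      using f by (auto simp: boundary_def separated_def)
    have *: "set p \<inter> A \<noteq> {}" if "is_path E tail head p" "hd p = f" "head (last p) = u" for p
      using fcut that by (auto simp: edge_cut_def)
    have "head f \<noteq> u"
      using *[of "[f]"] fE \<open>f \<notin> A\<close> by (auto simp: is_path_Cons)
    then obtain g where g: "g \<in> succs f" "g \<notin> separated u A"
      using f by (auto simp: boundary_def)
    then obtain p where p: "is_path E tail head p" "hd p = g" "head (last p) = u" "set p \<inter> A = {}"
      using assms by (auto simp: separated_def succs_def edge_cut_def)
    then have "p \<noteq> []" by (simp add: is_path_def)
    with p show False
      using *[of "f # p"] \<open>f \<notin> A\<close> fE g by (auto simp: is_path_Cons succs_def split: if_splits)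
  qed
qed

text \<open>An edge in one of the two left-hand boundaries lies in \<open>boundary u X\<close> or in
  \<open>boundary u Y\<close>, and an edge in both of them lies in both of these.\<close>

lemma card_boundary_submodular:
  assumes "X \<subseteq> E" "Y \<subseteq> E"
  shows "card (boundary u (X \<union> Y)) + card (boundary u (X \<inter> Y))
       \<le> card (boundary u X) + card (boundary u Y)"
proof -
  let ?b = "boundary u"
  have fin: "finite (?b Z)" if "Z \<subseteq> E" for Z
    using that finite_E by (auto simp: boundary_def intro: finite_subset)
  have fins: "finite (?b X)" "finite (?b Y)" "finite (?b (X \<union> Y))" "finite (?b (X \<inter> Y))"
    using assms by (auto intro!: fin)
  have "card (?b (X \<union> Y)) + card (?b (X \<inter> Y))
      = card (?b (X \<union> Y) \<union> ?b (X \<inter> Y)) + card (?b (X \<union> Y) \<inter> ?b (X \<inter> Y))"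
    using fins by (intro card_Un_Int)
  also have "\<dots> \<le> card (?b X \<union> ?b Y) + card (?b X \<inter> ?b Y)"
    using fins by (intro add_mono card_mono) (auto simp: boundary_def)
  also have "\<dots> = card (?b X) + card (?b Y)"
    using fins by (intro card_Un_Int[symmetric])
  finally show ?thesis .
qed

section \<open>Minimum cuts and their primary representatives\<close>

lemma finite_cut_cards: "finite {card A | A. cut \<xi> u A}"
proof -
  have "{card A | A. cut \<xi> u A} \<subseteq> card ` Pow E" by (auto simp: edge_cut_def)
  then show ?thesis by (rule finite_subset) (simp add: finite_E)
qed

lemma mincut_le: "cut \<xi> u A \<Longrightarrow> mincut \<xi> u \<le> card A"
  unfolding edge_mincut_def by (rule Min_le[OF finite_cut_cards]) auto

lemma mincut_attained: "\<exists>A. cut \<xi> u A \<and> card A = mincut \<xi> u"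
proof -
  have "cut \<xi> u E"
    by (intro edge_cutI) (auto simp: is_path_def Int_absorb2)
  then have "{card A | A. cut \<xi> u A} \<noteq> {}" by auto
  from Min_in[OF finite_cut_cards this] show ?thesis
    unfolding edge_mincut_def by auto
qed

lemma mincut_mono:
  assumes "\<eta> \<subseteq> \<xi>"
  shows "mincut \<eta> u \<le> mincut \<xi> u"
  using mincut_attained[of \<xi> u] mincut_le edge_cut_mono[OF _ assms] by metis

lemma mincut_insert_le:
  assumes "e \<in> E"
  shows "mincut (insert e \<xi>) u \<le> Suc (mincut \<xi> u)"
proof -
  obtain A where A: "cut \<xi> u A" "card A = mincut \<xi> u" using mincut_attained by blast
  have "cut (insert e \<xi>) u (insert e A)"
  proof (rule edge_cutI)
    show "insert e A \<subseteq> E" using A(1) assms by (simp add: edge_cut_def)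
    fix p assume p: "is_path E tail head p" "hd p \<in> insert e \<xi>" "head (last p) = u"
    then have "hd p \<in> set p" by (simp add: is_path_def)
    then show "set p \<inter> insert e A \<noteq> {}" using p edge_cutD[OF A(1)] by blast
  qed
  then have "mincut (insert e \<xi>) u \<le> card (insert e A)" by (rule mincut_le)
  moreover have "finite A" using A(1) finite_E by (auto simp: edge_cut_def intro: finite_subset)
  ultimately show ?thesis using A(2) by (simp add: card_insert_if split: if_splits)
qed

text \<open>By submodularity the supersets of \<xi> with boundary of minimum size are closed under
  union. The boundary of a maximal one is primary: every minimum cut \<open>B\<close> lies in
  \<open>separated u B\<close>, which belongs to the family and hence is contained in the maximal
  member.\<close>

lemma primary_mincut_exists:
  assumes "\<xi> \<subseteq> E"
  shows "\<exists>A. primary_mincut E tail head \<xi> u A"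
proof -
  define \<X> where "\<X> = {X. \<xi> \<subseteq> X \<and> X \<subseteq> E \<and> card (boundary u X) = mincut \<xi> u}"
  have ge: "mincut \<xi> u \<le> card (boundary u X)" if "\<xi> \<subseteq> X" "X \<subseteq> E" for X
    using mincut_le edge_cut_mono[OF cut_boundary[OF that(2)] that(1)] by blast
  have sep: "separated u B \<in> \<X>" if B: "cut \<xi> u B" "card B = mincut \<xi> u" for B
  proof -
    have BE: "B \<subseteq> E" using B by (auto simp: edge_cut_def)
    have "\<xi> \<subseteq> separated u B" using B BE assms cut_iff_separated by auto
    moreover have "separated u B \<subseteq> E" by (auto simp: separated_def)
    moreover have "card (boundary u (separated u B)) \<le> card B"
      using BE finite_E by (intro card_mono boundary_separated_subset) (auto intro: finite_subset)
    ultimately show ?thesis using ge B by (auto simp: \<X>_def intro!: antisym)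
  qed
  have "\<X> \<noteq> {}" using sep mincut_attained by blast
  moreover have "finite \<X>"
    by (rule finite_subset[of _ "Pow E"]) (auto simp: \<X>_def finite_E)
  ultimately obtain X where X: "X \<in> \<X>" and max: "\<And>Y. Y \<in> \<X> \<Longrightarrow> X \<subseteq> Y \<Longrightarrow> X = Y"
    using finite_has_maximal by metis
  have X': "\<xi> \<subseteq> X" "X \<subseteq> E" "card (boundary u X) = mincut \<xi> u" using X by (auto simp: \<X>_def)
  have "cut B u (boundary u X)" if B: "cut \<xi> u B" "card B = mincut \<xi> u" for B
  proof -
    let ?Y = "separated u B"
    have BE: "B \<subseteq> E" using B by (auto simp: edge_cut_def)
    have Y: "\<xi> \<subseteq> ?Y" "?Y \<subseteq> E" "card (boundary u ?Y) = mincut \<xi> u"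
      using sep[OF B] by (auto simp: \<X>_def)
    have "mincut \<xi> u \<le> card (boundary u (X \<union> ?Y))" "mincut \<xi> u \<le> card (boundary u (X \<inter> ?Y))"
      using X' Y by (auto intro!: ge)
    \<comment> \<open>Both boundaries have at least \<open>mincut \<xi> u\<close> edges and together
      at most twice as many, so both bounds are attained.\<close>
    then have "card (boundary u (X \<union> ?Y)) = mincut \<xi> u"
      using card_boundary_submodular[OF X'(2) Y(2), of u] X'(3) Y(3) by linarith
    then have "X \<union> ?Y \<in> \<X>" using X' Y by (auto simp: \<X>_def)
    then have "?Y \<subseteq> X" using max by blast
    moreover have "B \<subseteq> ?Y" using cut_iff_separated[OF BE BE, of u] edge_cut_self[OF BE, of tail head u] by simp
    ultimately show ?thesis by (intro edge_cut_mono[OF cut_boundary[OF X'(2)]]) simp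
  qed
  then have "primary_mincut E tail head \<xi> u (boundary u X)"
    using X' edge_cut_mono[OF cut_boundary[OF X'(2)] X'(1)] by (simp add: primary_mincut_def)
  then show ?thesis by blast
qed

text \<open>By transitivity a cut for \<open>A\<close> is also a cut for \<xi>. So \<open>A\<close>
  has no smaller cut than itself, and its minimum cuts are minimum cuts of \<xi>, to which primality
  applies.\<close>

lemma primary_mincut_primary_for:
  assumes "primary_mincut E tail head \<xi> u A"
  shows "primary_for E tail head A u"
proof -
  have A: "cut \<xi> u A" "card A = mincut \<xi> u"
    and pr: "\<And>B. cut \<xi> u B \<Longrightarrow> card B = mincut \<xi> u \<Longrightarrow> cut B u A"
    using assms by (auto simp: primary_mincut_def)
  have AA: "cut A u A" using A by (intro edge_cut_self) (auto simp: edge_cut_def)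
  obtain B where B: "cut A u B" "card B = mincut A u" using mincut_attained by blast
  have "mincut A u = card A"
    using mincut_le[OF AA] mincut_le[OF edge_cut_trans[OF A(1) B(1)]] A(2) B(2) by simp
  then show ?thesis
    using AA A pr edge_cut_trans[OF A(1)] by (auto simp: primary_for_def primary_mincut_def)
qed

text \<open>A minimum cut of the enlarged set is also a minimum cut of \<xi>; it separates
  \<open>e\<close> from \<open>u\<close>, and \<open>A\<close> in turn separates it from
  \<open>u\<close>. The point is that one and the same \<open>A\<close> serves for all such
  \<open>e\<close>.\<close>

lemma primary_mincut_separates:
  assumes "primary_mincut E tail head \<xi> u A" and "mincut (insert e \<xi>) u \<le> mincut \<xi> u"
  shows "cut {e} u A"
proof -
  obtain B where B: "cut (insert e \<xi>) u B" "card B = mincut (insert e \<xi>) u"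
    using mincut_attained by blast
  have "cut \<xi> u B" using B(1) by (rule edge_cut_mono) auto
  moreover have "card B = mincut \<xi> u" using B(2) assms(2) mincut_le[OF calculation] by simp
  ultimately have "cut B u A" using assms(1) by (auto simp: primary_mincut_def)
  with edge_cut_mono[OF B(1)] show ?thesis by (rule edge_cut_trans) auto
qed

text \<open>The augmentation property of a matroid rank function. If no single edge raised the
  minimum cut, the primary cut of \<xi> would cut off every edge of \<open>D\<close>, and hence all
  of \<open>\<xi> \<union> D\<close>.\<close>

lemma mincut_extend_one:
  assumes "\<xi> \<subseteq> E" "D \<subseteq> E" and less: "mincut \<xi> u < mincut (\<xi> \<union> D) u"
  shows "\<exists>e\<in>D. mincut (insert e \<xi>) u = Suc (mincut \<xi> u)"
proof (rule ccontr)
  assume no: "\<not> ?thesis"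
  obtain A where A: "primary_mincut E tail head \<xi> u A" using primary_mincut_exists assms(1) by blast
  have A': "cut \<xi> u A" "card A = mincut \<xi> u" using A by (auto simp: primary_mincut_def)
  have "cut {e} u A" if "e \<in> D" for e
  proof -
    have "mincut (insert e \<xi>) u \<noteq> Suc (mincut \<xi> u)" using no that by blast
    moreover have "mincut (insert e \<xi>) u \<le> Suc (mincut \<xi> u)"
      using that assms(2) by (intro mincut_insert_le) auto
    ultimately show ?thesis by (intro primary_mincut_separates[OF A]) simp
  qed
  moreover have "A \<subseteq> E" using A'(1) by (simp add: edge_cut_def)
  ultimately have "cut D u A" by (rule edge_cut_singletonI[rotated]) simp
  from mincut_le[OF edge_cut_Un[OF A'(1) this]] show False using A'(2) less by simp
qed

text \<open>Iterated augmentation. It serves both to fill up an error set until its minimum cut has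
  a prescribed size and to find source edges for the messages next to a primary set.\<close>

lemma mincut_extend:
  assumes "\<xi> \<subseteq> E" "D \<subseteq> E" "mincut \<xi> u + n \<le> mincut D u"
  shows "\<exists>D'\<subseteq>D. D' \<inter> \<xi> = {} \<and> card D' = n \<and> mincut (\<xi> \<union> D') u = mincut \<xi> u + n"
  using assms(3)
proof (induction n)
  case 0
  show ?case by (rule exI[of _ "{}"]) simp
next
  case (Suc n)
  then obtain D' where D': "D' \<subseteq> D" "D' \<inter> \<xi> = {}" "card D' = n"
    "mincut (\<xi> \<union> D') u = mincut \<xi> u + n" by auto
  have "mincut D u \<le> mincut (\<xi> \<union> D' \<union> D) u" by (rule mincut_mono) auto
  then have "mincut (\<xi> \<union> D') u < mincut (\<xi> \<union> D' \<union> D) u" using D'(4) Suc.prems by linarith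
  moreover have "\<xi> \<union> D' \<subseteq> E" using assms D'(1) by blast
  ultimately obtain e where e: "e \<in> D" "mincut (insert e (\<xi> \<union> D')) u = Suc (mincut \<xi> u + n)"
    using mincut_extend_one[OF _ assms(2)] D'(4) by metis
  have "e \<notin> \<xi> \<union> D'"
  proof
    assume "e \<in> \<xi> \<union> D'"
    then have "insert e (\<xi> \<union> D') = \<xi> \<union> D'" by blast
    then show False using e(2) D'(4) by simp
  qed
  moreover have "finite D'" using D'(1) assms(2) finite_E by (meson finite_subset)
  ultimately show ?case using D' e by (intro exI[of _ "insert e D'"]) auto
qed

text \<open>Fill up \<xi> with edges of \<open>D\<close> until its minimum cut is exactly
  \<open>n\<close>; the primary minimum cut of the result is the required \<eta>. Thus small error
  sets are controlled by the members of \<open>A_set\<close>.\<close>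

lemma A_set_covers:
  assumes "\<xi> \<subseteq> E" "D \<subseteq> E" "card \<xi> \<le> n" "n \<le> mincut D u"
  shows "\<exists>\<eta>\<in>A_set E tail head u n. cut \<xi> u \<eta>"
proof -
  have "mincut \<xi> u \<le> n"
    using mincut_le[OF edge_cut_self[OF assms(1)]] assms(3) by (rule order_trans)
  then obtain D' where D': "D' \<subseteq> D" "mincut (\<xi> \<union> D') u = n"
    using mincut_extend[OF assms(1,2), of u "n - mincut \<xi> u"] assms(4) by auto
  obtain \<eta> where \<eta>: "primary_mincut E tail head (\<xi> \<union> D') u \<eta>"
    using primary_mincut_exists[of "\<xi> \<union> D'"] D' assms by blast
  have "cut (\<xi> \<union> D') u \<eta>" "card \<eta> = n" using \<eta> D' by (auto simp: primary_mincut_def)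
  then show ?thesis using primary_mincut_primary_for[OF \<eta>]
    by (intro bexI[of _ \<eta>]) (auto simp: A_set_def edge_cut_def)
qed

end

subsection \<open>Independent families of vectors\<close>

lemma vscale_apply: "vscale c v y = c * v y"
  by (simp add: vscale_def)

lemma sum_fun_apply: "sum f A y = (\<Sum>a\<in>A. f a y)"
  by (induction A rule: infinite_finite_induct) auto

interpretation fun_vs: vector_space "vscale :: 'a::field \<Rightarrow> ('i \<Rightarrow> 'a) \<Rightarrow> 'i \<Rightarrow> 'a"
  by unfold_locales (auto simp: vscale_def fun_eq_iff algebra_simps)

lemma span_image_finite:
  fixes v :: "'j \<Rightarrow> 'i \<Rightarrow> 'a::field"
  assumes "finite J" and "w \<in> fun_vs.span (v ` J)"
  shows "\<exists>c. w = (\<Sum>j\<in>J. vscale (c j) (v j))"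
  using assms(2)
proof (induction rule: fun_vs.span_induct_alt)
  case base
  show ?case by (rule exI[of _ "\<lambda>_. 0"]) simp
next
  case (step a x y)
  then obtain i c where i: "i \<in> J" "x = v i" and c: "y = (\<Sum>j\<in>J. vscale (c j) (v j))" by auto
  have "(\<Sum>j\<in>J. vscale ((c(i := c i + a)) j) (v j))
      = (\<Sum>j\<in>J. vscale (c j) (v j) + (if j = i then vscale a (v i) else 0))"
    by (rule sum.cong) (auto simp: fun_vs.scale_left_distrib)
  also have "\<dots> = vscale a x + y"
    using i c assms(1) by (simp add: sum.distrib)
  finally show ?case by (intro exI[of _ "c(i := c i + a)"]) simp
qed

text \<open>Indexed families instead of sets of vectors: for finite \<open>J\<close>, equal rows at
  different indices count as dependent.\<close>

definition indep_family :: "'j set \<Rightarrow> ('j \<Rightarrow> 'i \<Rightarrow> 'a::field) \<Rightarrow> bool" where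
  "indep_family J v \<longleftrightarrow> (\<forall>x. (\<Sum>j\<in>J. vscale (x j) (v j)) = 0 \<longrightarrow> (\<forall>j\<in>J. x j = 0))"

lemma indep_familyD:
  "indep_family J v \<Longrightarrow> (\<Sum>j\<in>J. vscale (x j) (v j)) = 0 \<Longrightarrow> j \<in> J \<Longrightarrow> x j = 0"
  by (auto simp: indep_family_def)

lemma indep_family_cong:
  assumes "\<And>j. j \<in> J \<Longrightarrow> v j = w j"
  shows "indep_family J v \<longleftrightarrow> indep_family J w"
  using assms by (simp add: indep_family_def)

lemma indep_family_reindex:
  assumes "bij_betw f J K" "indep_family K w"
  shows "indep_family J (\<lambda>j. w (f j))"
  unfolding indep_family_def
proof (intro allI impI ballI)
  fix x j assume 0: "(\<Sum>j\<in>J. vscale (x j) (w (f j))) = 0" and j: "j \<in> J"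
  let ?g = "inv_into J f"
  have "(\<Sum>k\<in>K. vscale (x (?g k)) (w k)) = (\<Sum>j\<in>J. vscale (x (?g (f j))) (w (f j)))"
    by (rule sum.reindex_bij_betw[OF assms(1), symmetric])
  also have "\<dots> = 0"
    unfolding 0[symmetric] by (rule sum.cong) (use assms(1) in \<open>auto simp: bij_betw_def\<close>)
  finally have "x (?g (f j)) = 0"
    by (rule indep_familyD[OF assms(2)]) (use assms(1) j in \<open>auto simp: bij_betw_def\<close>)
  then show "x j = 0" using assms(1) j by (simp add: bij_betw_def)
qed

lemma indep_family_mono:
  assumes "indep_family K v" "J \<subseteq> K" "finite K"
  shows "indep_family J v"
  unfolding indep_family_def
proof (intro allI impI ballI)
  fix x j assume 0: "(\<Sum>j\<in>J. vscale (x j) (v j)) = 0" and j: "j \<in> J"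
  have "(\<Sum>k\<in>K. vscale (if k \<in> J then x k else 0) (v k)) = (\<Sum>j\<in>J. vscale (x j) (v j))"
    using assms by (intro sum.mono_neutral_cong_right) auto
  with 0 have "(if j \<in> J then x j else 0) = 0"
    using j assms by (intro indep_familyD[OF assms(1)]) auto
  then show "x j = 0" using j by simp
qed

lemma indep_family_inj_on:
  assumes "indep_family J v" "finite J"
  shows "inj_on v J"
proof (rule inj_onI, rule ccontr)
  fix i j assume ij: "i \<in> J" "j \<in> J" "v i = v j" "i \<noteq> j"
  have *: "indep_family {i, j} v" using ij by (intro indep_family_mono[OF assms(1) _ assms(2)]) auto
  have "(\<Sum>l\<in>{i, j}. vscale (if l = i then 1 else -1) (v l)) = 0"
    using ij by simp
  from indep_familyD[OF *, OF this, of i] show False by simp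
qed

lemma indep_family_independent:
  assumes "indep_family J v" "finite J"
  shows "fun_vs.independent (v ` J)"
proof -
  have "u w = 0" if "(\<Sum>w\<in>v ` J. vscale (u w) w) = 0" "w \<in> v ` J" for u w
    using that indep_familyD[OF assms(1), of "\<lambda>j. u (v j)"]
    by (auto simp: sum.reindex[OF indep_family_inj_on[OF assms]])
  then show ?thesis using assms(2) by (auto simp: fun_vs.dependent_finite)
qed

text \<open>Two representations of a common vector, one over \<open>J\<close> and one over
  \<open>K\<close>, differ by a vanishing combination over the disjoint union, so all coefficients
  are 0.\<close>

lemma indep_family_span_Int:
  assumes "indep_family (J \<union> K) v" "J \<inter> K = {}" "finite J" "finite K"
  shows "fun_vs.span (v ` J) \<inter> fun_vs.span (v ` K) = {0}"
proof -
  have "w = 0" if w: "w \<in> fun_vs.span (v ` J)" "w \<in> fun_vs.span (v ` K)" for w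
  proof -
    obtain a b where a: "w = (\<Sum>j\<in>J. vscale (a j) (v j))" and b: "w = (\<Sum>j\<in>K. vscale (b j) (v j))"
      using span_image_finite[OF assms(3) w(1)] span_image_finite[OF assms(4) w(2)] by blast
    let ?x = "\<lambda>j. if j \<in> J then a j else - b j"
    have "(\<Sum>j\<in>J \<union> K. vscale (?x j) (v j))
        = (\<Sum>j\<in>J. vscale (?x j) (v j)) + (\<Sum>j\<in>K. vscale (?x j) (v j))"
      using assms by (intro sum.union_disjoint)
    also have "(\<Sum>j\<in>K. vscale (?x j) (v j)) = (\<Sum>j\<in>K. - vscale (b j) (v j))"
      using assms(2) by (intro sum.cong) auto
    also have "\<dots> = - w" unfolding b by (simp add: sum_negf)
    also have "(\<Sum>j\<in>J. vscale (?x j) (v j)) = w" unfolding a by (rule sum.cong) auto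
    also have "w + - w = 0" by (rule right_minus)
    finally have "a j = 0" if "j \<in> J" for j
      using indep_familyD[OF assms(1), of ?x j] that by auto
    then show ?thesis using a by simp
  qed
  then show ?thesis using fun_vs.span_zero by auto
qed

text \<open>The determinant of a matrix perturbed by \<open>c\<close> times a rank-one matrix is affine in \<open>c\<close>.\<close>

lemma indep_family_rank_one_update:
  fixes v :: "'j \<Rightarrow> 'i \<Rightarrow> 'a::field"
  assumes "indep_family J v"
    and "\<not> indep_family J (\<lambda>j. v j + vscale (c * a j) u)"
    and "\<not> indep_family J (\<lambda>j. v j + vscale (d * a j) u)"
  shows "c = d"
proof (rule ccontr)
  assume "c \<noteq> d"
  \<comment> \<open>A relation among the updated vectors writes a multiple of \<open>u\<close> in
    terms of \<open>v\<close>. Its weight against \<open>a\<close> is nonzero, since otherwise it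
    would be a relation among the \<open>v\<close> themselves.\<close>
  have dep: "\<exists>x. (\<Sum>j\<in>J. vscale (x j) (v j)) = vscale (- (c * (\<Sum>j\<in>J. x j * a j))) u \<and>
      (\<Sum>j\<in>J. x j * a j) \<noteq> 0"
    if dep: "\<not> indep_family J (\<lambda>j. v j + vscale (c * a j) u)" for c
  proof -
    obtain x j where x: "(\<Sum>j\<in>J. vscale (x j) (v j + vscale (c * a j) u)) = 0"
      and j: "j \<in> J" "x j \<noteq> 0"
      using dep by (auto simp: indep_family_def)
    have "(\<Sum>j\<in>J. vscale (x j) (v j + vscale (c * a j) u))
        = (\<Sum>j\<in>J. vscale (x j) (v j)) + vscale (c * (\<Sum>j\<in>J. x j * a j)) u"
      by (simp add: fun_eq_iff sum_fun_apply vscale_apply sum.distrib sum_distrib_left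
          sum_distrib_right algebra_simps)
    then have *: "(\<Sum>j\<in>J. vscale (x j) (v j)) = - vscale (c * (\<Sum>j\<in>J. x j * a j)) u"
      using x by (simp add: eq_neg_iff_add_eq_0)
    have "(\<Sum>j\<in>J. x j * a j) \<noteq> 0"
    proof
      assume "(\<Sum>j\<in>J. x j * a j) = 0"
      then have "(\<Sum>j\<in>J. vscale (x j) (v j)) = 0" using * by simp
      then show False using indep_familyD[OF assms(1)] j by blast
    qed
    with * show ?thesis by (intro exI[of _ x]) simp
  qed
  obtain x where x: "(\<Sum>j\<in>J. vscale (x j) (v j)) = vscale (- (c * (\<Sum>j\<in>J. x j * a j))) u"
    and x0: "(\<Sum>j\<in>J. x j * a j) \<noteq> 0"
    using dep[OF assms(2)] by blast
  obtain y where y: "(\<Sum>j\<in>J. vscale (y j) (v j)) = vscale (- (d * (\<Sum>j\<in>J. y j * a j))) u"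
    and y0: "(\<Sum>j\<in>J. y j * a j) \<noteq> 0"
    using dep[OF assms(3)] by blast
  define \<alpha> \<beta> where "\<alpha> = (\<Sum>j\<in>J. x j * a j)" and "\<beta> = (\<Sum>j\<in>J. y j * a j)"
  \<comment> \<open>The two relations are combined so that the multiples of \<open>u\<close> cancel.
    Independence gives \<open>z = 0\<close>, while its weight against \<open>a\<close> is
    \<open>(d - c) * (\<alpha> * \<beta>)\<close>.\<close>
  define z where "z j = d * \<beta> * x j - c * \<alpha> * y j" for j
  have "(\<Sum>j\<in>J. vscale (z j) (v j))
      = vscale (d * \<beta>) (\<Sum>j\<in>J. vscale (x j) (v j)) - vscale (c * \<alpha>) (\<Sum>j\<in>J. vscale (y j) (v j))"
    by (simp add: z_def fun_eq_iff sum_fun_apply vscale_apply sum_subtractf sum_distrib_left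
        algebra_simps)
  also have "\<dots> = 0"
    by (simp add: x y fun_eq_iff vscale_apply \<alpha>_def[symmetric] \<beta>_def[symmetric])
  finally have "z j = 0" if "j \<in> J" for j using indep_familyD[OF assms(1)] that by blast
  then have "(\<Sum>j\<in>J. z j * a j) = 0" by simp
  moreover have "(\<Sum>j\<in>J. z j * a j) = d * \<beta> * (\<Sum>j\<in>J. x j * a j) - c * \<alpha> * (\<Sum>j\<in>J. y j * a j)"
    by (simp add: z_def sum_subtractf sum_distrib_left algebra_simps)
  then have "(\<Sum>j\<in>J. z j * a j) = d * \<beta> * \<alpha> - c * \<alpha> * \<beta>"
    by (simp add: \<alpha>_def \<beta>_def)
  ultimately have "(d - c) * (\<alpha> * \<beta>) = 0" by (auto simp: algebra_simps)
  then show False using \<open>c \<noteq> d\<close> x0 y0 by (simp add: \<alpha>_def \<beta>_def)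
qed

section \<open>Dimension counts for spans\<close>

lemma independent_Un:
  fixes S T :: "('i \<Rightarrow> 'a::field) set"
  assumes "fun_vs.independent S" "fun_vs.independent T" "finite S" "finite T"
    and "fun_vs.span S \<inter> fun_vs.span T = {0}"
  shows "fun_vs.independent (S \<union> T)" and "S \<inter> T = {}"
proof -
  show disj: "S \<inter> T = {}"
  proof (rule ccontr)
    assume "S \<inter> T \<noteq> {}"
    then obtain w where w: "w \<in> S" "w \<in> T" by blast
    then have "w = 0" using assms(5) fun_vs.span_base by blast
    then show False using w assms(1) fun_vs.dependent_zero by blast
  qed
  have "u w = 0" if u: "(\<Sum>w\<in>S \<union> T. vscale (u w) w) = 0" and w: "w \<in> S \<union> T" for u w
  proof -
    have eq: "(\<Sum>w\<in>S. vscale (u w) w) + (\<Sum>w\<in>T. vscale (u w) w) = 0"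
      using u disj assms by (simp add: sum.union_disjoint)
    have "(\<Sum>w\<in>S. vscale (u w) w) \<in> fun_vs.span S" "(\<Sum>w\<in>T. vscale (u w) w) \<in> fun_vs.span T"
      by (simp_all add: fun_vs.span_sum fun_vs.span_scale fun_vs.span_base)
    moreover have "(\<Sum>w\<in>S. vscale (u w) w) = - (\<Sum>w\<in>T. vscale (u w) w)"
      using eq by (simp add: eq_neg_iff_add_eq_0)
    ultimately have "(\<Sum>w\<in>S. vscale (u w) w) \<in> fun_vs.span S \<inter> fun_vs.span T"
      using fun_vs.span_neg by auto
    then have S0: "(\<Sum>w\<in>S. vscale (u w) w) = 0" using assms(5) by blast
    then have T0: "(\<Sum>w\<in>T. vscale (u w) w) = 0" using eq by simp
    from w show ?thesis
    proof
      show ?thesis if "w \<in> S" by (rule fun_vs.independentD[OF assms(1,3) order_refl S0 that])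
      show ?thesis if "w \<in> T" by (rule fun_vs.independentD[OF assms(2,4) order_refl T0 that])
    qed
  qed
  then show "fun_vs.independent (S \<union> T)"
    unfolding fun_vs.dependent_finite[OF finite_UnI[OF assms(3,4)]] by blast
qed

text \<open>Drop \<open>card I - 1\<close> members of \<open>A\<close>. If the remaining rows met
  the span of \<open>m\<close> only in 0, the span of all rows would contain \<open>card I\<close>
  independent vectors beyond a basis of the remaining ones, but only \<open>card I - 1\<close>
  generators were dropped.\<close>

lemma span_meets_small_subfamily:
  fixes m :: "'j \<Rightarrow> 'i \<Rightarrow> 'a::field" and r :: "'e \<Rightarrow> 'i \<Rightarrow> 'a"
  assumes "indep_family I m" "finite I" "I \<noteq> {}" "finite A" "card I \<le> card A"
    and "m ` I \<subseteq> fun_vs.span (r ` A)"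
  shows "\<exists>\<xi>\<subseteq>A. card \<xi> = card A - card I + 1 \<and>
           fun_vs.span (m ` I) \<inter> fun_vs.span (r ` \<xi>) \<noteq> {0}"
proof -
  have "card I - 1 \<le> card A" using assms(5) by simp
  then obtain A0 where A0: "A0 \<subseteq> A" "card A0 = card I - 1"
    by (meson obtain_subset_with_card_n)
  have fin: "finite A0" using A0 assms(4) finite_subset by blast
  have pos: "card I > 0" using assms(2,3) by (simp add: card_gt_0_iff)
  have card: "card (A - A0) = card A - card I + 1"
    using A0 fin pos assms(5) by (simp add: card_Diff_subset)
  have "fun_vs.span (m ` I) \<inter> fun_vs.span (r ` (A - A0)) \<noteq> {0}"
  proof
    assume triv: "fun_vs.span (m ` I) \<inter> fun_vs.span (r ` (A - A0)) = {0}"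
    \<comment> \<open>A basis of the span of the remaining rows; its size appears on both sides of
      the final count and cancels.\<close>
    obtain B where B: "B \<subseteq> r ` (A - A0)" "fun_vs.independent B" "r ` (A - A0) \<subseteq> fun_vs.span B"
      using fun_vs.maximal_independent_subset by blast
    have finB: "finite B" using B(1) assms(4) by (meson finite_Diff finite_imageI finite_subset)
    have "fun_vs.span B \<subseteq> fun_vs.span (r ` (A - A0))" using B(1) by (rule fun_vs.span_mono)
    then have triv': "fun_vs.span (m ` I) \<inter> fun_vs.span B = {0}"
      using triv fun_vs.span_zero by blast
    have ind: "fun_vs.independent (m ` I)" using assms by (intro indep_family_independent)
    note Un = independent_Un[OF ind B(2) finite_imageI[OF assms(2)] finB triv']
    have "r ` A \<subseteq> fun_vs.span (r ` A0 \<union> B)"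
    proof
      fix w assume "w \<in> r ` A"
      then have "w \<in> r ` A0 \<or> w \<in> r ` (A - A0)" by blast
      then have "w \<in> fun_vs.span (r ` A0) \<or> w \<in> fun_vs.span B"
        using B(3) fun_vs.span_superset[of "r ` A0"] by blast
      then show "w \<in> fun_vs.span (r ` A0 \<union> B)"
        using fun_vs.span_mono[of "r ` A0" "r ` A0 \<union> B"] fun_vs.span_mono[of B "r ` A0 \<union> B"] by blast
    qed
    then have "fun_vs.span (r ` A) \<subseteq> fun_vs.span (r ` A0 \<union> B)"
      by (simp add: fun_vs.span_minimal)
    then have "m ` I \<union> B \<subseteq> fun_vs.span (r ` A0 \<union> B)"
      using assms(6) fun_vs.span_superset[of "r ` A0 \<union> B"] by blast
    then have "card (m ` I \<union> B) \<le> card (r ` A0 \<union> B)"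
      using fun_vs.independent_span_bound[OF _ Un(1), of "r ` A0 \<union> B"] fin finB by simp
    also have "\<dots> \<le> card A0 + card B"
      using card_Un_le[of "r ` A0" B] card_image_le[OF fin, of r] by linarith
    finally have "card (m ` I) + card B \<le> card A0 + card B"
      using Un(2) finB assms(2) by (simp add: card_Un_disjoint)
    moreover have "card (m ` I) = card I"
      using indep_family_inj_on[OF assms(1,2)] by (rule card_image)
    ultimately show False using A0(2) pos by linarith
  qed
  then show ?thesis using card by (intro exI[of _ "A - A0"]) auto
qed

text \<open>A multilinear analogue of the Schwartz--Zippel argument: the variables are fixed one after
  the other, keeping for every index a completion that is still good.\<close>

lemma simultaneous_choice:
  fixes good :: "'p \<Rightarrow> ('b \<Rightarrow> 'a::finite) \<Rightarrow> bool"
  assumes "finite P" "finite X" "card P < card (UNIV :: 'a set)"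
    and ex: "\<And>p. p \<in> P \<Longrightarrow> \<exists>x. good p x"
    and one: "\<And>p x b c d. p \<in> P \<Longrightarrow> b \<in> X \<Longrightarrow> good p x \<Longrightarrow>
      \<not> good p (x(b := c)) \<Longrightarrow> \<not> good p (x(b := d)) \<Longrightarrow> c = d"
  shows "\<exists>x. \<forall>p\<in>P. \<exists>y. good p y \<and> (\<forall>b\<in>X. y b = x b)"
proof -
  have "\<exists>x. \<forall>p\<in>P. \<exists>y. good p y \<and> (\<forall>b\<in>Y. y b = x b)" if "finite Y" "Y \<subseteq> X" for Y
    using that
  proof (induction Y rule: finite_induct)
    case empty
    then show ?case using ex by auto
  next
    case (insert b Y)
    then obtain x where "\<forall>p\<in>P. \<exists>y. good p y \<and> (\<forall>b\<in>Y. y b = x b)" by auto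
    then obtain y where y: "\<And>p. p \<in> P \<Longrightarrow> good p (y p) \<and> (\<forall>b\<in>Y. y p b = x b)" by metis
    \<comment> \<open>The completion \<open>y p\<close> is itself good, so at most one value of the
      coordinate \<open>b\<close> spoils it. Altogether at most \<open>card P\<close> values are
      bad, too few to exhaust the type.\<close>
    define bad where "bad p = {c. \<not> good p ((y p)(b := c))}" for p
    have "card (bad p) \<le> 1" if "p \<in> P" for p
      using one[OF that, of b "y p"] y[OF that] insert.prems
      by (auto simp: bad_def card_le_Suc0_iff_eq)
    then have "card (\<Union>p\<in>P. bad p) \<le> (\<Sum>p\<in>P. 1)"
      using assms(1) by (intro order_trans[OF card_UN_le] sum_mono) auto
    then have "card (\<Union>p\<in>P. bad p) < card (UNIV :: 'a set)" using assms(3) by simp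
    then obtain c where "c \<notin> (\<Union>p\<in>P. bad p)" by (metis UNIV_eq_I less_irrefl)
    then have c: "good p ((y p)(b := c))" if "p \<in> P" for p using that by (auto simp: bad_def)
    show ?case
    proof (rule exI[of _ "x(b := c)"], rule ballI)
      fix p assume p: "p \<in> P"
      show "\<exists>z. good p z \<and> (\<forall>b'\<in>insert b Y. z b' = (x(b := c)) b')"
      proof (intro exI conjI ballI)
        show "good p ((y p)(b := c))" by (rule c[OF p])
        show "((y p)(b := c)) b' = (x(b := c)) b'" if "b' \<in> insert b Y" for b'
          using that y[OF p] by (cases "b' = b") auto
      qed
    qed
  qed
  then show ?thesis using assms(2) by blast
qed

subsection \<open>Edge responses\<close>

text \<open>Acyclicity in a form suited to recursion and induction; \<open>acyclic_dag\<close>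
  supplies a height \<open>h\<close>.\<close>

locale dag = finite_graph E tail head
  for E :: "'e set" and tail head :: "'e \<Rightarrow> 'v" +
  fixes h :: "'e \<Rightarrow> nat"
  assumes height_less: "\<And>e g. e \<in> E \<Longrightarrow> g \<in> succs e \<Longrightarrow> h g < h e"
begin

lemma succs_in: "g \<in> succs e \<Longrightarrow> g \<in> E"
  by (simp add: succs_def)

lemma height_induct [consumes 1, case_names edge]:
  assumes "e \<in> E" and "\<And>e. e \<in> E \<Longrightarrow> (\<And>g. g \<in> succs e \<Longrightarrow> P g) \<Longrightarrow> P e"
  shows "P e"
  using assms(1)
proof (induction "h e" arbitrary: e rule: less_induct)
  case less
  then show ?case using assms(2)[OF less.prems] height_less succs_in by metis
qed

text \<open>The response of all edges to a unit error on \<open>e\<close> is computed from the sinks towards the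
  source, so that rows of the transfer matrix satisfy a linear recursion.\<close>

primrec resp_upto :: "('e \<Rightarrow> 'e \<Rightarrow> 'a::field) \<Rightarrow> nat \<Rightarrow> 'e \<Rightarrow> 'e \<Rightarrow> 'a" where
  "resp_upto k 0 e = 0"
| "resp_upto k (Suc n) e = unitv e + (\<Sum>g\<in>succs e. vscale (k e g) (resp_upto k n g))"

text \<open>Entry \<open>y\<close> is the sum, over all paths from \<open>e\<close> to
  \<open>y\<close>, of the products of the coefficients along the path. Heights drop along a path,
  so one starting at \<open>e\<close> has at most \<open>Suc (h e)\<close> edges and this recursion
  depth suffices.\<close>

definition resp :: "('e \<Rightarrow> 'e \<Rightarrow> 'a::field) \<Rightarrow> 'e \<Rightarrow> 'e \<Rightarrow> 'a" where
  "resp k e = resp_upto k (Suc (h e)) e"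

lemma resp_upto_stable:
  "e \<in> E \<Longrightarrow> h e < n \<Longrightarrow> h e < m \<Longrightarrow> resp_upto k n e = resp_upto k m e"
proof (induction n arbitrary: e m)
  case (Suc n)
  then obtain m' where m: "m = Suc m'" by (cases m) auto
  have "resp_upto k n g = resp_upto k m' g" if "g \<in> succs e" for g
    using that height_less[OF Suc.prems(1) that] Suc.prems m by (intro Suc.IH succs_in) auto
  then show ?case by (simp add: m)
qed simp

lemma resp_rec:
  assumes "e \<in> E"
  shows "resp k e = unitv e + (\<Sum>g\<in>succs e. vscale (k e g) (resp k g))"
proof -
  have "resp_upto k (h e) g = resp k g" if "g \<in> succs e" for g
    unfolding resp_def using height_less[OF assms that] that
    by (intro resp_upto_stable succs_in) auto
  then show ?thesis by (simp add: resp_def)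
qed

lemma resp_rec_apply:
  "e \<in> E \<Longrightarrow> resp k e y = (if e = y then 1 else 0) + (\<Sum>g\<in>succs e. k e g * resp k g y)"
  by (subst resp_rec) (auto simp: sum_fun_apply vscale_apply unitv_def)

lemma resp_cong:
  assumes "e \<in> Z" "Z \<subseteq> E" and closed: "\<And>f g. f \<in> Z \<Longrightarrow> g \<in> succs f \<Longrightarrow> g \<in> Z"
    and eq: "\<And>f g. f \<in> Z \<Longrightarrow> g \<in> succs f \<Longrightarrow> k f g = k' f g"
  shows "resp k e = resp k' e"
proof -
  have "e \<in> E" using assms by blast
  then have "e \<in> Z \<longrightarrow> resp k e = resp k' e"
  proof (induction rule: height_induct)
    case (edge e)
    then show ?case using closed eq by (auto simp: resp_rec[of e])
  qed
  then show ?thesis using assms(1) by blast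
qed

text \<open>Heights drop along paths, so no path leads from \<open>g\<close> to
  \<open>d\<close>.\<close>

lemma resp_eq_0:
  assumes "g \<in> E" "h g < h d"
  shows "resp k g d = 0"
  using assms
proof (induction rule: height_induct)
  case (edge g)
  have "resp k g' d = 0" if "g' \<in> succs g" for g'
    using edge that height_less[OF edge.hyps that] by auto
  then show ?case using edge by (auto simp: resp_rec_apply[of g])
qed

text \<open>Here the last edge of a path is split off, whereas \<open>resp_rec\<close> splits off
  the first. This is the direction of the recursion in \<open>kernel_eqs\<close>, and so the link to
  the extended kernels.\<close>

lemma resp_forward:
  assumes "e \<in> E" "g \<in> E"
  shows "resp k e g = (if e = g then 1 else 0) + (\<Sum>d\<in>{d\<in>E. head d = tail g}. k d g * resp k e d)"
  using assms(1)
proof (induction rule: height_induct)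
  case (edge e)
  let ?P = "{d\<in>E. head d = tail g}"
  have finP: "finite ?P" using finite_E by simp
  have "(\<Sum>f\<in>succs e. k e f * resp k f g)
      = (\<Sum>f\<in>succs e. k e f * (if f = g then 1 else 0)) +
        (\<Sum>f\<in>succs e. k e f * (\<Sum>d\<in>?P. k d g * resp k f d))"
    using edge.IH by (simp add: algebra_simps sum.distrib)
  also have "(\<Sum>f\<in>succs e. k e f * (if f = g then 1 else 0)) = (if g \<in> succs e then k e g else 0)"
    by (simp add: finite_succs if_distrib sum.delta cong: if_cong)
  also have "\<dots> = (\<Sum>d\<in>?P. k d g * (if e = d then 1 else 0))"
    using assms(2) edge.hyps finP by (auto simp: succs_def if_distrib sum.delta' cong: if_cong)
  also have "(\<Sum>f\<in>succs e. k e f * (\<Sum>d\<in>?P. k d g * resp k f d))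
      = (\<Sum>d\<in>?P. k d g * (\<Sum>f\<in>succs e. k e f * resp k f d))"
    unfolding sum_distrib_left by (subst sum.swap) (simp add: algebra_simps)
  also have "(\<Sum>d\<in>?P. k d g * (if e = d then 1 else 0)) +
      (\<Sum>d\<in>?P. k d g * (\<Sum>f\<in>succs e. k e f * resp k f d)) = (\<Sum>d\<in>?P. k d g * resp k e d)"
    using edge.hyps by (simp add: resp_rec_apply[of e] sum.distrib[symmetric] distrib_left)
  finally show ?case using edge.hyps by (simp add: resp_rec_apply[of e])
qed

text \<open>In an acyclic graph a path passes from \<open>d\<close> to \<open>f\<close> at most
  once. The added terms are therefore products of a path from \<open>e\<close> to \<open>d\<close>,
  the increment \<open>c\<close>, and a path from \<open>f\<close> to \<open>y\<close>: a rank-one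
  change.\<close>

lemma resp_update:
  assumes d: "d \<in> E" "f \<in> succs d" and e: "e \<in> E"
  shows "resp (k(d := (k d)(f := k d f + c))) e y = resp k e y + c * resp k e d * resp k f y"
proof -
  define k' where "k' = k(d := (k d)(f := k d f + c))"
  from e have "resp k' e y = resp k e y + c * resp k e d * resp k f y"
  proof (induction rule: height_induct)
    case (edge e)
    show ?case
    proof (cases "e = d")
      case False
      then have "k' e g = k e g" for g by (simp add: k'_def)
      then have "resp k' e y = (if e = y then 1 else 0) +
          (\<Sum>g\<in>succs e. k e g * (resp k g y + c * resp k g d * resp k f y))"
        using edge by (subst resp_rec_apply) simp_all
      also have "\<dots> = resp k e y + c * (\<Sum>g\<in>succs e. k e g * resp k g d) * resp k f y"
        using edge.hyps by (simp add: resp_rec_apply[of e] algebra_simps sum.distrib sum_distrib_left)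
      finally show ?thesis using False edge.hyps by (simp add: resp_rec_apply[of e k d])
    next
      case True
      have low: "h g < h d" "g \<in> E" if "g \<in> succs d" for g
        using that height_less d(1) succs_in by auto
      \<comment> \<open>All edges reachable from a successor of \<open>d\<close> lie below
        \<open>d\<close> in height, where \<open>k\<close> and \<open>k'\<close> agree.\<close>
      have same: "resp k' g = resp k g" if "g \<in> succs d" for g
        using low[OF that] by (intro resp_cong[where Z = "{f \<in> E. h f < h d}"])
          (auto simp: k'_def dest: height_less succs_in intro: less_trans)
      have dd: "resp k d d = 1"
        using d(1) low by (simp add: resp_rec_apply[of d] resp_eq_0)
      have k'd: "k' d g = k d g + (if g = f then c else 0)" for g by (simp add: k'_def)
      have "(\<Sum>g\<in>succs d. k' d g * resp k' g y)
          = (\<Sum>g\<in>succs d. k d g * resp k g y + (if g = f then c * resp k f y else 0))"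
        by (intro sum.cong refl) (simp add: same k'd distrib_right)
      also have "\<dots> = (\<Sum>g\<in>succs d. k d g * resp k g y) + c * resp k f y"
        using d(2) by (simp add: sum.distrib finite_succs)
      finally have "resp k' d y = resp k d y + c * resp k f y"
        by (simp only: resp_rec_apply[OF d(1)] add.assoc)
      then show ?thesis by (simp add: dd True)
    qed
  qed
  then show ?thesis by (simp add: k'_def)
qed

section \<open>Rows of the transfer matrix at a sink\<close>

definition out_row :: "'v \<Rightarrow> ('e \<Rightarrow> 'e \<Rightarrow> 'a::field) \<Rightarrow> 'e \<Rightarrow> 'e \<Rightarrow> 'a" where
  "out_row t k e = (\<lambda>y. if y \<in> E \<and> head y = t then resp k e y else 0)"

lemma out_row_rec:
  assumes "e \<in> E"
  shows "out_row t k e =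
    (if head e = t then unitv e else 0) + (\<Sum>g\<in>succs e. vscale (k e g) (out_row t k g))"
  using assms
  by (auto simp: fun_eq_iff out_row_def sum_fun_apply vscale_apply unitv_def resp_rec_apply[of e])

lemma out_row_update:
  assumes "d \<in> E" "f \<in> succs d" "e \<in> E"
  shows "out_row t (k(d := (k d)(f := k d f + c))) e
       = out_row t k e + vscale (c * resp k e d) (out_row t k f)"
  using resp_update[OF assms, of k c] by (auto simp: fun_eq_iff out_row_def vscale_apply)

text \<open>Induction on the height: a separated edge outside \<open>A\<close> does not enter
  \<open>t\<close>, and all its successors are separated, so its row is a combination of rows
  already known to lie in the span.\<close>

lemma out_row_in_span_cut:
  assumes "cut \<xi> t A" "\<xi> \<subseteq> E" "e \<in> \<xi>"
  shows "out_row t k e \<in> fun_vs.span (out_row t k ` A)"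
proof -
  have A: "A \<subseteq> E" using assms(1) by (simp add: edge_cut_def)
  have "e \<in> E" using assms by blast
  then have "e \<in> separated t A \<longrightarrow> ?thesis"
  proof (induction rule: height_induct)
    case (edge e)
    show ?case
    proof
      assume e: "e \<in> separated t A"
      show "out_row t k e \<in> fun_vs.span (out_row t k ` A)"
      proof (cases "e \<in> A")
        case True
        then show ?thesis by (simp add: fun_vs.span_base)
      next
        case False
        then have "e \<notin> boundary t (separated t A)" using boundary_separated_subset[OF A] by blast
        then have "head e \<noteq> t" "succs e \<subseteq> separated t A" using e by (auto simp: boundary_def)
        then show ?thesis
          using edge by (subst out_row_rec) (auto intro!: fun_vs.span_sum fun_vs.span_scale)
      qed
    qed
  qed
  moreover have "e \<in> separated t A" using assms cut_iff_separated[OF A assms(2)] by blast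
  ultimately show ?thesis by blast
qed

text \<open>This replaces Menger's theorem: pushing the highest edge of \<open>S\<close> first, repeated steps
  trace out edge-disjoint paths to \<open>t\<close>.\<close>

lemma mincut_push:
  assumes "S \<subseteq> E" "mincut S t = card S" "e \<in> S" "head e \<noteq> t"
  shows "\<exists>g\<in>succs e. g \<notin> S - {e} \<and> mincut (insert g (S - {e})) t = card S"
proof -
  let ?S = "S - {e}"
  have fin: "finite S" using assms(1) finite_E by (rule finite_subset)
  have card: "card S = Suc (card ?S)" using fin assms(3) by (rule card.remove)
  have SE: "?S \<subseteq> E" using assms(1) by blast
  have ins: "insert e ?S = S" using assms(3) by blast
  have "mincut ?S t \<le> card ?S" by (rule mincut_le[OF edge_cut_self[OF SE]])
  moreover have "card S \<le> Suc (mincut ?S t)"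
    using mincut_insert_le[of e ?S t] assms ins by auto
  ultimately have m: "mincut ?S t = card ?S" using card by simp
  \<comment> \<open>As \<open>e\<close> does not enter \<open>t\<close>, its paths to
    \<open>t\<close> pass through \<open>succs e\<close>. Replacing \<open>e\<close> by all its
    successors thus keeps the minimum cut at least \<open>card S\<close>, and augmentation selects
    one successor that makes up for the removal of \<open>e\<close>.\<close>
  obtain A where A: "cut (?S \<union> succs e) t A" "card A = mincut (?S \<union> succs e) t"
    using mincut_attained by blast
  have "cut S t A"
  proof (rule edge_cutI)
    show "A \<subseteq> E" using A(1) by (simp add: edge_cut_def)
    fix p assume p: "is_path E tail head p" "hd p \<in> S" "head (last p) = t"
    show "set p \<inter> A \<noteq> {}"
    proof (cases "hd p = e")
      case False
      then show ?thesis using p by (intro edge_cutD[OF A(1)]) auto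
    next
      case True
      then obtain q where q: "p = e # q" using p(1) by (cases p) (auto simp: is_path_def)
      then have "q \<noteq> []" using p(3) assms(4) by auto
      then have "is_path E tail head q" "hd q \<in> succs e" "head (last q) = t"
        using p q is_path_hd_in[of E tail head q] by (auto simp: is_path_Cons succs_def)
      then have "set q \<inter> A \<noteq> {}" by (intro edge_cutD[OF A(1)]) auto
      then show ?thesis using q by auto
    qed
  qed
  then have "card S \<le> mincut (?S \<union> succs e) t" using mincut_le A(2) assms(2) by metis
  then have "mincut ?S t < mincut (?S \<union> succs e) t" using m card by simp
  then obtain g where g: "g \<in> succs e" "mincut (insert g ?S) t = Suc (mincut ?S t)"
    using mincut_extend_one[OF SE] succs_in by (metis subsetI)
  then have "g \<notin> ?S" by (metis insert_absorb n_not_Suc_n)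
  then show ?thesis using g m card by auto
qed

text \<open>Induction on the total height of \<open>S\<close>. If all its edges enter
  \<open>t\<close>, zero coefficients give unit vectors. Otherwise an edge is replaced by a lower
  successor and its row is made equal to the row of that successor.\<close>

lemma exists_independent_out_rows:
  assumes "S \<subseteq> E" "mincut S t = card S" and sink: "\<And>e. e \<in> E \<Longrightarrow> tail e \<noteq> t"
  shows "\<exists>k :: 'e \<Rightarrow> 'e \<Rightarrow> 'a::field. indep_family S (out_row t k)"
  using assms(1,2)
proof (induction "\<Sum>e\<in>S. h e" arbitrary: S rule: less_induct)
  case less
  have fin: "finite S" using less.prems(1) finite_E by (rule finite_subset)
  show ?case
  proof (cases "\<forall>e\<in>S. head e = t")
    case True
    have row: "out_row t (\<lambda>_ _. 0 :: 'a) e = unitv e" if "e \<in> S" for e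
      using that True less.prems(1) by (subst out_row_rec) auto
    have "x j = 0" if 0: "(\<Sum>e\<in>S. vscale (x e) (unitv e)) = (0 :: 'e \<Rightarrow> 'a)" and j: "j \<in> S" for x j
    proof -
      have "(\<Sum>e\<in>S. vscale (x e) (unitv e)) j = x j"
        using j fin by (simp add: sum_fun_apply vscale_apply unitv_def if_distrib cong: if_cong)
      then show ?thesis using 0 by simp
    qed
    then have "indep_family S (unitv :: 'e \<Rightarrow> 'e \<Rightarrow> 'a)" by (auto simp: indep_family_def)
    then have "indep_family S (out_row t (\<lambda>_ _. 0 :: 'a))"
      using indep_family_cong[of S "out_row t (\<lambda>_ _. 0 :: 'a)" unitv] row by blast
    then show ?thesis by blast
  next
    case False
    define U where "U = {e \<in> S. head e \<noteq> t}"
    have "finite (h ` U)" "h ` U \<noteq> {}" using False fin by (auto simp: U_def)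
    then obtain e where e: "e \<in> U" "h e = Max (h ` U)" using Max_in by (metis imageE)
    have max: "h f \<le> h e" if "f \<in> U" for f
      using that e(2) \<open>finite (h ` U)\<close> by simp
    have eS: "e \<in> S" "head e \<noteq> t" "e \<in> E" using e less.prems by (auto simp: U_def)
    obtain g where g: "g \<in> succs e" "g \<notin> S - {e}" "mincut (insert g (S - {e})) t = card S"
      using mincut_push[OF less.prems eS(1,2)] by blast
    define S' where "S' = insert g (S - {e})"
    have hg: "h g < h e" using height_less eS(3) g(1) by blast
    have "S' \<subseteq> E" using less.prems(1) succs_in[OF g(1)] by (auto simp: S'_def)
    moreover have "card S' = card S"
      unfolding S'_def card.remove[OF fin eS(1)] using fin g(2) by (intro card_insert_disjoint) auto
    ultimately have S': "S' \<subseteq> E" "mincut S' t = card S'" using g(3) by (simp_all add: S'_def)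
    have "(\<Sum>e\<in>S'. h e) < (\<Sum>e\<in>S. h e)"
      using fin g(2) hg sum.remove[OF fin eS(1), of h] by (simp add: S'_def)
    then obtain k' :: "'e \<Rightarrow> 'e \<Rightarrow> 'a" where k': "indep_family S' (out_row t k')"
      using less.hyps S' by blast
    \<comment> \<open>With 1 towards \<open>g\<close> and 0 towards every other successor,
      \<open>e\<close> merely forwards its symbol to \<open>g\<close>.\<close>
    define k where "k = k'(e := unitv g)"
    have same: "out_row t k f = out_row t k' f" if "f \<in> S'" for f
    proof -
      have "resp k f = resp k' f"
      \<comment> \<open>This set contains \<open>S'\<close> by the choice of \<open>e\<close> as
        highest edge not entering \<open>t\<close>. It avoids \<open>e\<close> and is closed under
        successors: heights drop, and edges entering the sink have no successors.\<close>
      proof (rule resp_cong[where Z = "{f \<in> E. f \<noteq> e \<and> (h f \<le> h e \<or> head f = t)}"])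
        show "f \<in> {f \<in> E. f \<noteq> e \<and> (h f \<le> h e \<or> head f = t)}"
          using that S'(1) hg max eS by (auto simp: S'_def U_def)
        fix f1 f2 assume f: "f1 \<in> {f \<in> E. f \<noteq> e \<and> (h f \<le> h e \<or> head f = t)}" "f2 \<in> succs f1"
        then have "head f1 \<noteq> t" using sink by (auto simp: succs_def)
        then show "f2 \<in> {f \<in> E. f \<noteq> e \<and> (h f \<le> h e \<or> head f = t)}"
          using f height_less[of f1 f2] succs_in by auto
        show "k f1 f2 = k' f1 f2" using f by (auto simp: k_def)
      qed auto
      then show ?thesis by (auto simp: out_row_def fun_eq_iff)
    qed
    have "out_row t k e = (\<Sum>f\<in>succs e. vscale (unitv g f) (out_row t k f))"
      using eS by (subst out_row_rec) (simp_all add: k_def)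
    also have "\<dots> = (\<Sum>f\<in>succs e. if f = g then out_row t k g else 0)"
      by (rule sum.cong) (auto simp: unitv_def)
    also have "\<dots> = out_row t k g" using g(1) by (simp add: finite_succs)
    finally have eg: "out_row t k e = out_row t k g" .
    let ?f = "\<lambda>f. if f = e then g else f"
    have "bij_betw ?f S S'"
      using g(2) eS(1) by (auto simp: bij_betw_def inj_on_def S'_def split: if_splits)
    from indep_family_reindex[OF this k'] have "indep_family S (\<lambda>f. out_row t k' (?f f))" .
    moreover have "out_row t k f = out_row t k' (?f f)" if "f \<in> S" for f
      using that same eg by (auto simp: S'_def)
    ultimately have "indep_family S (out_row t k)"
      using indep_family_cong[of S "out_row t k" "\<lambda>f. out_row t k' (?f f)"] by blast
    then show ?thesis by blast
  qed
qed

end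

subsection \<open>Extended kernels and MDS codes\<close>

text \<open>The height of \<open>e\<close> is the number of edges strictly downstream of it.
  Everything downstream of a successor \<open>g\<close> is downstream of \<open>e\<close>, but
  \<open>g\<close> is not downstream of itself.\<close>

lemma acyclic_dag:
  assumes "finite E" and acyc: "\<And>p. is_path E tail head p \<Longrightarrow> tail (hd p) \<noteq> head (last p)"
  shows "\<exists>h. dag E tail head h"
proof -
  interpret finite_graph E tail head by standard (rule assms(1))
  define r where "r = {(g, e). e \<in> E \<and> g \<in> succs e}"
  \<comment> \<open>The path stops just before \<open>g\<close>; for \<open>g = e\<close> it would
    be closed at \<open>tail e\<close>.\<close>
  have path: "\<exists>p. is_path E tail head p \<and> hd p = e \<and> head (last p) = tail g" if "(g, e) \<in> r\<^sup>+" for g e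
    using that
  proof (induction rule: trancl_induct)
    case (base e)
    then show ?case by (intro exI[of _ "[e]"]) (auto simp: r_def succs_def is_path_Cons)
  next
    case (step e' e)
    then obtain p where p: "is_path E tail head p" "hd p = e'" "head (last p) = tail g" by blast
    then have "p \<noteq> []" by (simp add: is_path_def)
    with p step.hyps(2) show ?case
      by (intro exI[of _ "e # p"]) (auto simp: r_def succs_def is_path_Cons)
  qed
  have irrefl: "(e, e) \<notin> r\<^sup>+" for e
    using path[of e e] acyc by force
  have fin: "finite {x. (x, e) \<in> r\<^sup>+}" for e
  proof (rule finite_subset[OF _ assms(1)])
    show "{x. (x, e) \<in> r\<^sup>+} \<subseteq> E"
      by (auto dest!: tranclD simp: r_def succs_def)
  qed
  have "card {x. (x, g) \<in> r\<^sup>+} < card {x. (x, e) \<in> r\<^sup>+}" if "e \<in> E" "g \<in> succs e" for e g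
  proof (rule psubset_card_mono[OF fin])
    have ge: "(g, e) \<in> r" using that by (simp add: r_def)
    then have "{x. (x, g) \<in> r\<^sup>+} \<subseteq> {x. (x, e) \<in> r\<^sup>+}" by (auto intro: trancl_into_trancl)
    moreover have "g \<in> {x. (x, e) \<in> r\<^sup>+}" "g \<notin> {x. (x, g) \<in> r\<^sup>+}" using ge irrefl by auto
    ultimately show "{x. (x, g) \<in> r\<^sup>+} \<subset> {x. (x, e) \<in> r\<^sup>+}" by blast
  qed
  then have "dag E tail head (\<lambda>e. card {x. (x, e) \<in> r\<^sup>+})" by unfold_locales
  then show ?thesis by blast
qed

section \<open>Codes, their coefficients and their rows\<close>

context dag
begin

text \<open>\<open>K\<close> packs \<open>kS\<close> (at \<open>Inl i\<close>) and \<open>kE\<close>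
  (at \<open>Inr d\<close>) into one function, so that all coefficients can be varied uniformly. A
  message row is a combination of the error rows of the edges leaving \<open>s\<close>.\<close>

definition code_row :: "'v \<Rightarrow> 'v \<Rightarrow> ((nat + 'e) \<times> 'e \<Rightarrow> 'a::field) \<Rightarrow> nat + 'e \<Rightarrow> 'e \<Rightarrow> 'a" where
  "code_row s t K x = (case x of
     Inl i \<Rightarrow> \<Sum>e\<in>{e \<in> E. tail e = s}. vscale (K (Inl i, e)) (out_row t (\<lambda>d g. K (Inr d, g)) e)
   | Inr e \<Rightarrow> out_row t (\<lambda>d g. K (Inr d, g)) e)"

text \<open>The equations determine an edge from its predecessors, which have larger height; hence
  the measure \<open>N - h e\<close>.\<close>

lemma kernel_eqs_unique:
  assumes "kernel_eqs E tail head s \<omega> kS kE F" "kernel_eqs E tail head s \<omega> kS kE F'"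
  shows "F = F'"
proof
  fix e
  obtain N where N: "\<And>e. e \<in> E \<Longrightarrow> h e \<le> N"
    using finite_E by (metis Max_ge finite_imageI imageI)
  show "F e = F' e"
  proof (cases "e \<in> E")
    case True
    then show ?thesis
    proof (induction "N - h e" arbitrary: e rule: less_induct)
      case less
      have "F d = F' d" if d: "d \<in> E" "head d = tail e" for d
      proof -
        have "h e < h d" using d less.prems height_less[of d e] by (simp add: succs_def)
        then show ?thesis using N[OF d(1)] d(1) by (intro less.hyps) auto
      qed
      then have "(\<Sum>d\<in>{d\<in>E. head d = tail e}. vscale (kE d e) (F d))
          = (\<Sum>d\<in>{d\<in>E. head d = tail e}. vscale (kE d e) (F' d))"
        by (intro sum.cong) auto
      then show ?case using assms less.prems by (simp add: kernel_eqs_def)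
    qed
  next
    case False
    then show ?thesis using assms by (simp add: kernel_eqs_def)
  qed
qed

text \<open>The right-hand sides solve \<open>kernel_eqs\<close> by \<open>resp_forward\<close>, and
  the solution is unique. For an edge leaving \<open>s\<close> only the unit term of
  \<open>resp_forward\<close> survives, as no edge enters \<open>s\<close>.\<close>

lemma ext_kernel_eq:
  fixes kE :: "'e \<Rightarrow> 'e \<Rightarrow> 'a::field"
  assumes source: "\<And>e. e \<in> E \<Longrightarrow> head e \<noteq> s" and "g \<in> E"
  shows "i \<in> {1..\<omega>} \<Longrightarrow> ext_kernel E tail head s \<omega> kS kE g (Inl i)
           = (\<Sum>e\<in>{e \<in> E. tail e = s}. kS i e * resp kE e g)"
    and "e \<in> E \<Longrightarrow> ext_kernel E tail head s \<omega> kS kE g (Inr e) = resp kE e g"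
proof -
  let ?O = "{e \<in> E. tail e = s}"
  \<comment> \<open>The value 0 at indices that are neither messages nor errors on edges of
    \<open>E\<close> is forced by the kernel equations.\<close>
  define F where "F g x = (if g \<in> E then case x of
       Inl i \<Rightarrow> if i \<in> {1..\<omega>} then \<Sum>e\<in>?O. kS i e * resp kE e g else 0
     | Inr e \<Rightarrow> if e \<in> E then resp kE e g else 0 else 0)" for g x
  have finO: "finite ?O" using finite_E by simp
  have "kernel_eqs E tail head s \<omega> kS kE F"
    unfolding kernel_eqs_def
  proof (intro conjI allI impI ballI)
    fix g assume "g \<notin> E" then show "F g = (\<lambda>_. 0)" by (simp add: F_def fun_eq_iff)
  next
    fix g assume g: "g \<in> E"
    let ?P = "{d\<in>E. head d = tail g}"
    show "F g = (if tail g = s then (\<Sum>i\<in>{1..\<omega>}. vscale (kS i g) (unitv (Inl i)))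
         else (\<Sum>d\<in>?P. vscale (kE d g) (F d))) + unitv (Inr g)"
    proof
      fix x
      show "F g x = ((if tail g = s then (\<Sum>i\<in>{1..\<omega>}. vscale (kS i g) (unitv (Inl i)))
         else (\<Sum>d\<in>?P. vscale (kE d g) (F d))) + unitv (Inr g)) x"
      proof (cases "tail g = s")
        case True
        then have "?P = {}" using source by auto
        then have resp: "resp kE e g = (if e = g then 1 else 0)" if "e \<in> E" for e
          using resp_forward[OF that g, of kE] by (simp only: sum.empty add_0_right)
        show ?thesis
        proof (cases x)
          case (Inl i)
          have "(\<Sum>e\<in>?O. kS i e * resp kE e g) = (\<Sum>e\<in>?O. if e = g then kS i g else 0)"
            by (rule sum.cong) (auto simp: resp)
          also have "\<dots> = kS i g" using g True finO by (simp add: sum.delta)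
          finally have 1: "(\<Sum>e\<in>?O. kS i e * resp kE e g) = kS i g" .
          have "(\<Sum>j\<in>{1..\<omega>}. vscale (kS j g) (unitv (Inl j))) x
              = (\<Sum>j\<in>{1..\<omega>}. if j = i then kS i g else 0)"
            unfolding sum_fun_apply by (rule sum.cong) (auto simp: vscale_apply unitv_def Inl)
          then have "(\<Sum>j\<in>{1..\<omega>}. vscale (kS j g) (unitv (Inl j))) x = (if i \<in> {1..\<omega>} then kS i g else 0)"
            by (simp add: sum.delta)
          then show ?thesis using g True 1 Inl by (simp add: F_def unitv_def)
        next
          case (Inr e)
          have "(\<Sum>j\<in>{1..\<omega>}. vscale (kS j g) (unitv (Inl j))) x = 0"
            unfolding sum_fun_apply by (rule sum.neutral) (auto simp: vscale_apply unitv_def Inr)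
          then show ?thesis using g True Inr resp by (auto simp: F_def unitv_def)
        qed
      next
        case False
        show ?thesis
        proof (cases x)
          case (Inl i)
          have "(\<Sum>e\<in>?O. kS i e * resp kE e g) = (\<Sum>e\<in>?O. kS i e * (\<Sum>d\<in>?P. kE d g * resp kE e d))"
            using False by (intro sum.cong refl) (auto simp: resp_forward[OF _ g])
          also have "\<dots> = (\<Sum>d\<in>?P. kE d g * (\<Sum>e\<in>?O. kS i e * resp kE e d))"
            unfolding sum_distrib_left by (subst sum.swap) (simp add: algebra_simps)
          finally have 1: "(\<Sum>e\<in>?O. kS i e * resp kE e g)
              = (\<Sum>d\<in>?P. kE d g * (\<Sum>e\<in>?O. kS i e * resp kE e d))" .
          have "(\<Sum>d\<in>?P. vscale (kE d g) (F d)) x = (if i \<in> {1..\<omega>} then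
              (\<Sum>d\<in>?P. kE d g * (\<Sum>e\<in>?O. kS i e * resp kE e d)) else 0)"
            unfolding sum_fun_apply by (cases "i \<in> {1..\<omega>}") (auto simp: vscale_apply F_def Inl)
          then show ?thesis using g False 1 Inl by (simp add: F_def[of g] unitv_def)
        next
          case (Inr e)
          have "(\<Sum>d\<in>?P. vscale (kE d g) (F d)) x = (if e \<in> E then
              (\<Sum>d\<in>?P. kE d g * resp kE e d) else 0)"
            unfolding sum_fun_apply by (simp add: vscale_apply F_def Inr)
          then show ?thesis using g False Inr resp_forward[OF _ g, of e kE]
            by (auto simp: F_def[of g] unitv_def)
        qed
      qed
    qed
  qed
  then have "ext_kernel E tail head s \<omega> kS kE = F"
    unfolding ext_kernel_def using kernel_eqs_unique by (intro the_equality) blast+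
  then show "i \<in> {1..\<omega>} \<Longrightarrow> ext_kernel E tail head s \<omega> kS kE g (Inl i)
           = (\<Sum>e\<in>?O. kS i e * resp kE e g)"
    and "e \<in> E \<Longrightarrow> ext_kernel E tail head s \<omega> kS kE g (Inr e) = resp kE e g"
    using \<open>g \<in> E\<close> by (simp_all add: F_def)
qed

lemma row_eq_code_row:
  assumes "\<And>e. e \<in> E \<Longrightarrow> head e \<noteq> s" and "x \<in> Inl ` {1..\<omega>} \<union> Inr ` E"
  shows "row E tail head s \<omega> (\<lambda>i e. K (Inl i, e)) (\<lambda>d e. K (Inr d, e)) t x = code_row s t K x"
proof (cases x)
  case (Inl i)
  then show ?thesis using assms(2)
    by (auto simp: fun_eq_iff row_def code_row_def out_row_def sum_fun_apply vscale_apply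
        ext_kernel_eq(1)[OF assms(1)])
next
  case (Inr e)
  then show ?thesis using assms(2)
    by (auto simp: fun_eq_iff row_def code_row_def out_row_def ext_kernel_eq(2)[OF assms(1)])
qed

text \<open>Only these finitely many entries of \<open>K\<close> influence the rows, so they can be
  fixed one at a time.\<close>

definition coeff_index :: "'v \<Rightarrow> nat \<Rightarrow> ((nat + 'e) \<times> 'e) set" where
  "coeff_index s \<omega> = Inl ` {1..\<omega>} \<times> {e \<in> E. tail e = s} \<union> (\<Union>d\<in>E. {Inr d} \<times> succs d)"

lemma finite_coeff_index: "finite (coeff_index s \<omega>)"
  by (simp add: coeff_index_def finite_E finite_succs)

lemma code_row_cong:
  assumes "\<And>b. b \<in> coeff_index s \<omega> \<Longrightarrow> K b = K' b" and "x \<in> Inl ` {1..\<omega>} \<union> Inr ` E"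
  shows "code_row s t K x = code_row s t K' x"
proof -
  have "resp (\<lambda>d g. K (Inr d, g)) e = resp (\<lambda>d g. K' (Inr d, g)) e" if "e \<in> E" for e
    using that by (rule resp_cong) (auto simp: succs_in coeff_index_def intro!: assms(1))
  then have *: "out_row t (\<lambda>d g. K (Inr d, g)) e = out_row t (\<lambda>d g. K' (Inr d, g)) e" if "e \<in> E" for e
    using that by (auto simp: out_row_def fun_eq_iff)
  show ?thesis
  proof (cases x)
    case (Inl i)
    then have "K (Inl i, e) = K' (Inl i, e)" if "e \<in> E" "tail e = s" for e
      using that assms(2) by (intro assms(1)) (auto simp: coeff_index_def)
    then show ?thesis using Inl * by (simp add: code_row_def)
  next
    case (Inr e)
    then show ?thesis using * assms(2) by (auto simp: code_row_def)
  qed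
qed

text \<open>In both cases \<open>u\<close> is the row of the edge \<open>f\<close> that the
  coefficient feeds. The factor \<open>a x\<close> is the indicator of \<open>Inl i\<close> for a
  source coefficient, and the response of \<open>d\<close> to the input \<open>x\<close> for an
  inner one.\<close>

lemma code_row_update:
  assumes "b \<in> coeff_index s \<omega>"
  shows "\<exists>a u. \<forall>c. \<forall>x\<in>Inl ` {1..\<omega>} \<union> Inr ` E.
    code_row s t (K(b := c)) x = code_row s t K x + vscale ((c - K b) * a x) u"
proof -
  let ?k = "\<lambda>d g. K (Inr d, g)"
  let ?O = "{e \<in> E. tail e = s}"
  have finO: "finite ?O" using finite_E by simp
  from assms consider i f where "b = (Inl i, f)" "f \<in> ?O"
    | d f where "b = (Inr d, f)" "d \<in> E" "f \<in> succs d"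
    by (auto simp: coeff_index_def)
  then show ?thesis
  proof cases
    case 1
    have "code_row s t (K(b := c)) x
        = code_row s t K x + vscale ((c - K b) * (if x = Inl i then 1 else 0)) (out_row t ?k f)" for c x
    proof (cases x)
      case (Inl j)
      show ?thesis
      proof (cases "j = i")
        case True
        have "code_row s t (K(b := c)) x = (\<Sum>e\<in>?O. vscale (K (Inl i, e)) (out_row t ?k e) +
            (if e = f then vscale (c - K b) (out_row t ?k f) else 0))"
          unfolding code_row_def Inl sum.case
          by (rule sum.cong) (auto simp: 1 True fun_vs.scale_left_diff_distrib)
        also have "\<dots> = code_row s t K x + vscale (c - K b) (out_row t ?k f)"
          using 1 finO by (simp add: sum.distrib code_row_def Inl True)
        finally show ?thesis using Inl True by simp
      next
        case False
        then show ?thesis using Inl 1 by (simp add: code_row_def)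
      qed
    next
      case (Inr e)
      then show ?thesis using 1 by (simp add: code_row_def)
    qed
    then show ?thesis
      by (intro exI[of _ "\<lambda>x. if x = Inl i then 1 else 0"] exI[of _ "out_row t ?k f"]) blast
  next
    case 2
    define a where "a = case_sum (\<lambda>i. \<Sum>e\<in>?O. K (Inl i, e) * resp ?k e d) (\<lambda>e. resp ?k e d)"
    have upd: "out_row t (\<lambda>d g. (K(b := c)) (Inr d, g)) e
        = out_row t ?k e + vscale ((c - K b) * resp ?k e d) (out_row t ?k f)" if "e \<in> E" for c e
    proof -
      have "(\<lambda>d g. (K(b := c)) (Inr d, g)) = ?k(d := (?k d)(f := ?k d f + (c - K b)))"
        using 2(1) by (auto simp: fun_eq_iff)
      then show ?thesis using out_row_update[OF 2(2,3) that, of t ?k "c - K b"] by simp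
    qed
    have "code_row s t (K(b := c)) x = code_row s t K x + vscale ((c - K b) * a x) (out_row t ?k f)"
      if "x \<in> Inl ` {1..\<omega>} \<union> Inr ` E" for c x
    proof (cases x)
      case (Inl j)
      have "code_row s t (K(b := c)) x = (\<Sum>e\<in>?O. vscale (K (Inl j, e))
          (out_row t ?k e + vscale ((c - K b) * resp ?k e d) (out_row t ?k f)))"
        unfolding code_row_def Inl sum.case
        by (intro sum.cong refl arg_cong2[of _ _ _ _ vscale] upd) (auto simp: 2(1))
      also have "\<dots> = code_row s t K x + vscale ((c - K b) * a x) (out_row t ?k f)"
        by (simp add: fun_eq_iff code_row_def Inl a_def sum_fun_apply vscale_apply distrib_left
            sum.distrib sum_distrib_left sum_distrib_right mult.assoc mult.left_commute)
      finally show ?thesis .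
    next
      case (Inr e)
      then show ?thesis using that upd[of e c] by (auto simp: code_row_def a_def)
    qed
    then show ?thesis by blast
  qed
qed

text \<open>Joint independence covers both requirements: the message rows are independent, and the
  message space meets the error space of \<xi> only in 0.\<close>

definition separates :: "'v \<Rightarrow> nat \<Rightarrow> 'v \<Rightarrow> 'e set \<Rightarrow> ((nat + 'e) \<times> 'e \<Rightarrow> 'a::field) \<Rightarrow> bool" where
  "separates s \<omega> t \<xi> K \<longleftrightarrow> indep_family (Inl ` {1..\<omega>} \<union> Inr ` \<xi>) (code_row s t K)"

text \<open>A primary \<xi> is its own minimum cut, so it extends by \<omega> edges leaving
  \<open>s\<close> to a set whose minimum cut equals its size. Independent rows for this set exist,
  and the messages are fed directly into the added edges.\<close>

lemma separates_exists:
  assumes "\<xi> \<in> A_set E tail head t n" and "n + \<omega> \<le> mincut {e \<in> E. tail e = s} t"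
    and sink: "\<And>e. e \<in> E \<Longrightarrow> tail e \<noteq> t"
  shows "\<exists>K :: (nat + 'e) \<times> 'e \<Rightarrow> 'a::field. separates s \<omega> t \<xi> K"
proof -
  let ?O = "{e \<in> E. tail e = s}"
  have \<xi>: "\<xi> \<subseteq> E" "card \<xi> = n" "mincut \<xi> t = n"
    using assms(1) by (auto simp: A_set_def primary_for_def primary_mincut_def)
  obtain D where D: "D \<subseteq> ?O" "D \<inter> \<xi> = {}" "card D = \<omega>" "mincut (\<xi> \<union> D) t = n + \<omega>"
    using mincut_extend[OF \<xi>(1), of ?O t \<omega>] \<xi>(3) assms(2) by auto
  have fin: "finite \<xi>" "finite D" using \<xi>(1) D(1) finite_E by (auto intro: finite_subset)
  have "card (\<xi> \<union> D) = n + \<omega>" using fin D \<xi>(2) by (simp add: card_Un_disjoint Int_commute)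
  then obtain k :: "'e \<Rightarrow> 'e \<Rightarrow> 'a" where k: "indep_family (\<xi> \<union> D) (out_row t k)"
    using exists_independent_out_rows[of "\<xi> \<union> D" t] \<xi>(1) D sink by auto
  obtain b where b: "bij_betw b {1..\<omega>} D"
    using ex_bij_betw_nat_finite_1[OF fin(2)] D(3) by auto
  \<comment> \<open>Message \<open>i\<close> enters only the edge \<open>b i\<close>, with
    coefficient 1, so its row is the row of that edge.\<close>
  define K where "K = (\<lambda>(x, g). case_sum (\<lambda>i. if g = b i then 1 else 0) (\<lambda>d. k d g) x)"
  let ?f = "case_sum b id"
  let ?J = "Inl ` {1..\<omega>} \<union> Inr ` \<xi>"
  have bij_l: "bij_betw ?f (Inl ` {1..\<omega>}) D"
  proof (rule bij_betw_imageI)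
    show "inj_on ?f (Inl ` {1..\<omega>})"
      by (rule inj_on_imageI) (use bij_betw_imp_inj_on[OF b] in \<open>simp add: case_sum_o_inj\<close>)
    show "?f ` Inl ` {1..\<omega>} = D"
      unfolding image_image sum.case by (rule bij_betw_imp_surj_on[OF b])
  qed
  have bij_r: "bij_betw ?f (Inr ` \<xi>) \<xi>"
    by (rule bij_betw_imageI) (auto simp: inj_on_def image_image)
  have "bij_betw ?f ?J (\<xi> \<union> D)"
    using bij_betw_combine[OF bij_l bij_r D(2)] by (simp only: Un_commute)
  from indep_family_reindex[OF this k] have "indep_family ?J (\<lambda>x. out_row t k (?f x))" .
  moreover have "code_row s t K x = out_row t k (?f x)" if "x \<in> ?J" for x
  proof (cases x)
    case (Inl i)
    then have bi: "b i \<in> ?O" using that b D(1) by (auto simp: bij_betw_def)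
    have "code_row s t K x = (\<Sum>e\<in>?O. if e = b i then out_row t k (b i) else 0)"
      unfolding code_row_def Inl sum.case by (rule sum.cong) (auto simp: K_def)
    also have "\<dots> = out_row t k (b i)" using bi finite_E by (simp add: sum.delta)
    finally show ?thesis using Inl by simp
  next
    case (Inr e)
    then show ?thesis by (simp add: code_row_def K_def)
  qed
  ultimately have "indep_family ?J (code_row s t K)"
    using indep_family_cong[of ?J "code_row s t K" "\<lambda>x. out_row t k (?f x)"] by blast
  then show ?thesis unfolding separates_def by blast
qed

lemma separates_update:
  assumes "b \<in> coeff_index s \<omega>" "\<xi> \<subseteq> E" "separates s \<omega> t \<xi> K"
    and "\<not> separates s \<omega> t \<xi> (K(b := c))" "\<not> separates s \<omega> t \<xi> (K(b := d))"
  shows "c = d"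
proof -
  let ?J = "Inl ` {1..\<omega>} \<union> Inr ` \<xi>"
  from code_row_update[OF assms(1), of t K] obtain a u where au: "\<forall>c. \<forall>x\<in>Inl ` {1..\<omega>} \<union> Inr ` E.
      code_row s t (K(b := c)) x = code_row s t K x + vscale ((c - K b) * a x) u"
    by (elim exE)
  have upd: "separates s \<omega> t \<xi> (K(b := c))
      \<longleftrightarrow> indep_family ?J (\<lambda>x. code_row s t K x + vscale ((c - K b) * a x) u)" for c
    unfolding separates_def
    by (rule indep_family_cong) (rule au[rule_format], use assms(2) in blast)
  have "c - K b = d - K b"
    by (rule indep_family_rank_one_update[OF assms(3)[unfolded separates_def]
          assms(4)[unfolded upd] assms(5)[unfolded upd]])
  then show ?thesis by simp
qed

text \<open>At most \<open>C - \<omega>\<close> errors are cut off by a member of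
  \<open>A_set\<close>, whose error space contains theirs and meets the message space trivially.
  Conversely, the message rows lie in the span of the rows of a minimum cut of \<open>C\<close>
  edges, and a dimension count yields the Singleton bound.\<close>

lemma mds_at_sink:
  fixes K :: "(nat + 'e) \<times> 'e \<Rightarrow> 'a::field"
  assumes source: "\<And>e. e \<in> E \<Longrightarrow> head e \<noteq> s" and "\<omega> \<ge> 1" and C: "\<omega> \<le> C" "mincut {e \<in> E. tail e = s} t = C"
    and sep: "\<And>\<xi>. \<xi> \<in> A_set E tail head t (C - \<omega>) \<Longrightarrow> separates s \<omega> t \<xi> K"
  defines "kS \<equiv> \<lambda>i e. K (Inl i, e)" and "kE \<equiv> \<lambda>d e. K (Inr d, e)"
  shows "fun_vs.dim (msg_space E tail head s \<omega> kS kE t) = \<omega>"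
    and "dmin E tail head s \<omega> kS kE t = C - \<omega> + 1"
proof -
  let ?O = "{e \<in> E. tail e = s}"
  let ?M = "fun_vs.span (code_row s t K ` Inl ` {1..\<omega>})"
  let ?D = "\<lambda>\<xi>. fun_vs.span (code_row s t K ` Inr ` \<xi>)"
  have row: "row E tail head s \<omega> kS kE t x = code_row s t K x" if "x \<in> Inl ` {1..\<omega>} \<union> Inr ` E" for x
    unfolding kS_def kE_def using that by (intro row_eq_code_row source)
  have msg: "msg_space E tail head s \<omega> kS kE t = ?M"
    unfolding msg_space_def image_image by (intro arg_cong[of _ _ fun_vs.span] image_cong refl row) auto
  have err: "err_space E tail head s \<omega> kS kE t \<xi> = ?D \<xi>" if "\<xi> \<subseteq> E" for \<xi>
    unfolding err_space_def image_image using that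
    by (intro arg_cong[of _ _ fun_vs.span] image_cong refl row) auto
  have fin: "finite \<xi>" if "\<xi> \<subseteq> E" for \<xi> using that finite_E by (rule finite_subset)
  have OE: "?O \<subseteq> E" by blast
  have CO: "C - \<omega> \<le> mincut ?O t" using C by simp
  have cut_span: "?D \<xi> \<subseteq> ?D A" if "cut \<xi> t A" "\<xi> \<subseteq> E" for \<xi> A
  proof -
    have "code_row s t K ` Inr ` \<xi> \<subseteq> ?D A"
      using out_row_in_span_cut[OF that] by (auto simp: code_row_def image_image)
    then show ?thesis by (simp add: fun_vs.span_minimal)
  qed
  \<comment> \<open>Covering the empty error set shows that \<open>A_set\<close> is nonempty, which
    gives independence of the message rows.\<close>
  obtain \<eta>0 where \<eta>0: "\<eta>0 \<in> A_set E tail head t (C - \<omega>)"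
    using A_set_covers[of "{}" ?O "C - \<omega>" t] CO by auto
  then have "finite \<eta>0" by (intro fin) (auto simp: A_set_def)
  then have ind: "indep_family (Inl ` {1..\<omega>}) (code_row s t K)"
    using sep[OF \<eta>0] unfolding separates_def by (elim indep_family_mono) auto
  have card_I: "card (Inl ` {1..\<omega>} :: (nat + 'e) set) = \<omega>" by (simp add: card_image)
  have "card (code_row s t K ` Inl ` {1..\<omega>}) = \<omega>"
    using card_image[OF indep_family_inj_on[OF ind]] card_I by simp
  then show "fun_vs.dim (msg_space E tail head s \<omega> kS kE t) = \<omega>"
    unfolding msg using fun_vs.dim_span_eq_card_independent[OF indep_family_independent[OF ind]] by simp
  have lower: "C - \<omega> + 1 \<le> card \<xi>" if \<xi>: "\<xi> \<subseteq> E" "?M \<inter> ?D \<xi> \<noteq> {0}" for \<xi>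
  proof (rule ccontr)
    assume "\<not> ?thesis"
    then obtain \<eta> where \<eta>: "\<eta> \<in> A_set E tail head t (C - \<omega>)" "cut \<xi> t \<eta>"
      using A_set_covers[OF \<xi>(1) OE _ CO] by auto
    have \<eta>E: "\<eta> \<subseteq> E" using \<eta>(1) by (simp add: A_set_def)
    have "?M \<inter> ?D \<eta> = {0}"
      using sep[OF \<eta>(1)] fin[OF \<eta>E] unfolding separates_def
      by (intro indep_family_span_Int) auto
    then have "?M \<inter> ?D \<xi> \<subseteq> {0}" using cut_span[OF \<eta>(2) \<xi>(1)] by blast
    moreover have "0 \<in> ?M \<inter> ?D \<xi>" by (simp add: fun_vs.span_zero)
    ultimately show False using \<xi>(2) by blast
  qed
  obtain A where A: "cut ?O t A" "card A = C" using mincut_attained[of ?O t] C(2) by auto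
  have AE: "A \<subseteq> E" using A(1) by (simp add: edge_cut_def)
  have "code_row s t K ` Inl ` {1..\<omega>} \<subseteq> fun_vs.span ((\<lambda>e. code_row s t K (Inr e)) ` A)"
  proof -
    have "code_row s t K (Inl i) \<in> fun_vs.span ((\<lambda>e. code_row s t K (Inr e)) ` A)" for i
      unfolding code_row_def sum.case
      by (intro fun_vs.span_sum fun_vs.span_scale out_row_in_span_cut[OF A(1) OE])
    then show ?thesis by blast
  qed
  then obtain \<xi> where \<xi>: "\<xi> \<subseteq> A" "card \<xi> = C - \<omega> + 1"
      "?M \<inter> fun_vs.span ((\<lambda>e. code_row s t K (Inr e)) ` \<xi>) \<noteq> {0}"
    using span_meets_small_subfamily[OF ind, of A "\<lambda>e. code_row s t K (Inr e)"]
      fin[OF AE] A(2) C(1) card_I \<open>\<omega> \<ge> 1\<close> by auto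
  define Z where "Z = {card \<xi> | \<xi>. \<xi> \<subseteq> E \<and>
        msg_space E tail head s \<omega> kS kE t \<inter> err_space E tail head s \<omega> kS kE t \<xi> \<noteq> {0}}"
  have "Min Z = C - \<omega> + 1"
  proof (rule Min_eqI)
    show "finite Z"
      by (rule finite_subset[of _ "card ` Pow E"]) (auto simp: Z_def finite_E)
    show "C - \<omega> + 1 \<le> y" if "y \<in> Z" for y
    proof -
      obtain \<xi> where "y = card \<xi>" "\<xi> \<subseteq> E"
        "msg_space E tail head s \<omega> kS kE t \<inter> err_space E tail head s \<omega> kS kE t \<xi> \<noteq> {0}"
        using \<open>y \<in> Z\<close> unfolding Z_def by blast
      then show ?thesis using lower[of \<xi>] msg err[of \<xi>] by simp
    qed
    have "\<xi> \<subseteq> E" using \<xi>(1) AE by blast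
    then show "C - \<omega> + 1 \<in> Z"
      using \<xi>(2,3) msg err[of \<xi>] unfolding Z_def image_image by (intro CollectI exI[of _ \<xi>]) simp
  qed
  then show "dmin E tail head s \<omega> kS kE t = C - \<omega> + 1" by (simp add: dmin_def Z_def)
qed

end

section \<open>Coefficients serving all sinks at once\<close>

theorem theorem16:
  fixes V :: "'v set" and E :: "'e set" and tail head :: "'e \<Rightarrow> 'v"
    and s :: 'v and T :: "'v set" and \<omega> :: nat
  assumes "network V E tail head s T"
    and "\<omega> \<ge> 1"
    and "\<forall>t\<in>T. node_mincut E tail head s t \<ge> \<omega>"
    and "card (UNIV :: 'a set) >
           (\<Sum>t\<in>T. card (A_set E tail head t (node_mincut E tail head s t - \<omega>)))"
  shows "\<exists>(kS :: nat \<Rightarrow> 'e \<Rightarrow> 'a::{field,finite}) (kE :: 'e \<Rightarrow> 'e \<Rightarrow> 'a). LNEC_MDS E tail head s T \<omega> kS kE"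
proof -
  let ?C = "node_mincut E tail head s"
  let ?A = "\<lambda>t. A_set E tail head t (?C t - \<omega>)"
  have finE: "finite E" and finT: "finite T"
    using assms(1) by (auto simp: network_def intro: finite_subset)
  have source: "\<And>e. e \<in> E \<Longrightarrow> head e \<noteq> s" and sink: "\<And>e t. t \<in> T \<Longrightarrow> e \<in> E \<Longrightarrow> tail e \<noteq> t"
    using assms(1) by (auto simp: network_def)
  obtain h where "dag E tail head h"
    using acyclic_dag[OF finE, of tail head] assms(1) by (auto simp: network_def)
  then interpret dag E tail head h .
  have C: "?C t = mincut {e \<in> E. tail e = s} t" for t by (rule node_mincut_eq_edge_mincut)
  have finA: "finite (?A t)" for t
    by (rule finite_subset[of _ "Pow E"]) (auto simp: A_set_def finE)
  \<comment> \<open>One condition per sink and primary set, so that \<open>card P\<close> is the sum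
    bounding the field size.\<close>
  define P where "P = (SIGMA t:T. ?A t)"
  have P: "finite P" using finT finA by (simp add: P_def)
  have cardP: "card P < card (UNIV :: 'a set)"
    using assms(4) finT finA by (simp add: P_def card_SigmaI)
  have ex: "\<exists>K :: (nat + 'e) \<times> 'e \<Rightarrow> 'a. case_prod (separates s \<omega>) p K" if "p \<in> P" for p
    using that assms(3) C sink by (auto simp: P_def intro!: separates_exists)
  have one: "c = d"
    if "p \<in> P" "b \<in> coeff_index s \<omega>" "case_prod (separates s \<omega>) p K"
      "\<not> case_prod (separates s \<omega>) p (K(b := c))" "\<not> case_prod (separates s \<omega>) p (K(b := d))"
    for p b and K :: "(nat + 'e) \<times> 'e \<Rightarrow> 'a" and c d
    using that separates_update[OF that(2), of "snd p" "fst p" K c d]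
    by (auto simp: P_def A_set_def split: prod.splits)
  have "\<exists>K :: (nat + 'e) \<times> 'e \<Rightarrow> 'a. \<forall>p\<in>P. \<exists>K'. case_prod (separates s \<omega>) p K' \<and>
      (\<forall>b\<in>coeff_index s \<omega>. K' b = K b)"
    using P finite_coeff_index cardP by (rule simultaneous_choice) (fact ex, fact one)
  then obtain K :: "(nat + 'e) \<times> 'e \<Rightarrow> 'a" where
    K: "\<forall>p\<in>P. \<exists>K'. case_prod (separates s \<omega>) p K' \<and> (\<forall>b\<in>coeff_index s \<omega>. K' b = K b)"
    by (elim exE)
  \<comment> \<open>Each pair comes with its own good completion \<open>K'\<close>. It agrees with
    \<open>K\<close> on all coefficients that determine the rows, so \<open>K\<close> is good for
    every pair.\<close>
  have sep: "separates s \<omega> t \<xi> K" if t: "t \<in> T" "\<xi> \<in> ?A t" for t \<xi>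
  proof -
    have "(t, \<xi>) \<in> P" using t by (simp add: P_def)
    from bspec[OF K this] obtain K' where
      K': "separates s \<omega> t \<xi> K'" "\<forall>b\<in>coeff_index s \<omega>. K' b = K b"
      unfolding prod.case by (elim exE conjE)
    have "\<xi> \<subseteq> E" using t by (simp add: A_set_def)
    then have "indep_family (Inl ` {1..\<omega>} \<union> Inr ` \<xi>) (code_row s t K')
        = indep_family (Inl ` {1..\<omega>} \<union> Inr ` \<xi>) (code_row s t K)"
      using K'(2) by (intro indep_family_cong code_row_cong) auto
    then show ?thesis using K'(1) by (simp add: separates_def)
  qed
  have "LNEC_MDS E tail head s T \<omega> (\<lambda>i e. K (Inl i, e)) (\<lambda>d e. K (Inr d, e))"
    unfolding LNEC_MDS_def
    using mds_at_sink[OF source assms(2) _ C[symmetric] sep] assms(3) by simp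
  then show ?thesis by blast
qed

end
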